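(* Let $\Lambda$ be a finitely aligned $k$-graph. Then $\Lambda$ is aperiodic if and only if the boundary-path groupoid $\mathcal{G}_\Lambda$ is effective.
   Context: $\mathbb{N}$ contains $0$; for $m,n\in\mathbb{N}^k$ ($k\ge 1$), $m\le n$ and $m\vee n$ (maximum) are taken coordinatewise. A $k$-graph $\Lambda$ is a countable small category with a functor $d:\Lambda\to\mathbb{N}^k$ ($\mathbb{N}^k$ viewed as a category with one object) satisfying the factorisation property: if $d(\lambda)=m+n$ there are unique $\mu,\nu\in\Lambda$ with $\lambda=\mu\nu$, $d(\mu)=m$, $d(\nu)=n$; write $\lambda(0,m)=\mu$, $\lambda(m,m+n)=\nu$. $\Lambda^0$ denotes the objects (vertices), identified with the identity morphisms, i.e. the morphisms of degree $0$. $r(\lambda), s(\lambda)$ are the range (codomain) and source (domain); $\lambda\mu$ is defined when $s(\lambda)=r(\mu)$. $v\Lambda=\{\lambda\in\Lambda: r(\lambda)=v\}$; $\Lambda v=\{\lambda\in\Lambda:s(\lambda)=v\}$. For $\lambda,\mu\in\Lambda$, $\operatorname{MCE}(\lambda,\mu)$ is the set of $\tau\in\Lambda$ with $d(\tau)=d(\lambda)\vee d(\mu)$, $\tau(0,d(\lambda))=\lambda$, $\tau(0,d(\mu))=\mu$, and $\Lambda^{\min}(\lambda,\mu)=\{(\rho,\tau)\in\Lambda\times\Lambda:\lambda\rho=\mu\tau\in\operatorname{MCE}(\lambda,\mu)\}$. $\Lambda$ is finitely aligned if every $\Lambda^{\min}(\lambda,\mu)$ is finite (possibly empty). A set $E\subseteq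 v\Lambda$ is exhaustive if for every $\lambda\in v\Lambda$ there is $\mu\in E$ with $\Lambda^{\min}(\lambda,\mu)\ne\emptyset$. $\operatorname{FE}(\Lambda)$ is the collection of all finite exhaustive sets $E\subseteq v\Lambda\setminus\{v\}$, $v\in\Lambda^0$; for such $E$, $r(E):=v$. Boundary paths: for $m\in(\mathbb{N}\cup\{\infty\})^k$, $\Omega_{k,m}=\{(p,q)\in\mathbb{N}^k\times\mathbb{N}^k:p\le q\le m\}$ is the $k$-graph with objects $\{p\in\mathbb{N}^k:p\le m\}$, $r(p,q)=p$, $s(p,q)=q$, $d(p,q)=q-p$. A boundary path of $\Lambda$ is a degree-preserving functor $x:\Omega_{k,m}\to\Lambda$ such that for every $n\in\mathbb{N}^k$ with $n\le m$ and every $E\in\operatorname{FE}(\Lambda)$ with $r(E)=x(n,n)$ there is $\lambda\in E$ with $n+d(\lambda)\le m$ and $x(n,n+d(\lambda))=\lambda$. Put $d(x)=m$, $x(n)=x(n,n)$, $r(x)=x(0)$. $\partial\Lambda$ is the set of boundary paths; $v\partial\Lambda=\{x\in\partial\Lambda:r(x)=v\}$. For $n\le d(x)$, $\sigma^nx\in\partial\Lambda$ is given by $(\sigma^nx)(p,q)=x(n+p,n+q)$; for $\lambda\in\Lambda$ with $s(\lambda)=r(x)$, $\lambda x\in\partial\Lambda$ is the boundary path with $(\lambda x)(0,d(\lambda))=\lambda$ and $\sigma^{d(\lambda)}(\lambda x)=x$; $\lambda\partial\Lambda=\{\lambda x:x\in s(\lambda)\partial\Lambda\}$. Boundary-path groupoid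 $\mathcal{G}_\Lambda$: unit space $\partial\Lambda$ (with $x$ identified with $(x,0,x)$); morphisms are the triples $(\lambda z,d(\lambda)-d(\mu),\mu z)\in\partial\Lambda\times\mathbb{Z}^k\times\partial\Lambda$ with $\lambda,\mu\in\Lambda$, $s(\lambda)=s(\mu)$, $z\in s(\lambda)\partial\Lambda$; $r(x,m,y)=x$, $s(x,m,y)=y$, $(x,m,y)(y,n,w)=(x,m+n,w)$, $(x,m,y)^{-1}=(y,-m,x)$. For $s(\lambda)=s(\mu)$ and finite non-exhaustive $G\subseteq s(\lambda)\Lambda$, let $Z_\Lambda(\lambda)=\lambda\partial\Lambda$, $Z_\Lambda(\lambda*_s\mu)=\{(x,d(\lambda)-d(\mu),y)\in\mathcal{G}_\Lambda:x\in Z_\Lambda(\lambda),\,y\in Z_\Lambda(\mu),\,\sigma^{d(\lambda)}x=\sigma^{d(\mu)}y\}$ and $Z_\Lambda(\lambda*_s\mu\setminus G)=Z_\Lambda(\lambda*_s\mu)\setminus\bigcup_{\nu\in G}Z_\Lambda(\lambda\nu*_s\mu\nu)$. The sets $Z_\Lambda(\lambda*_s\mu\setminus G)$ form a basis of compact open bisections for a second-countable Hausdorff topology making $\mathcal{G}_\Lambda$ an ample topological groupoid. A boundary path $x$ is aperiodic if for all $\lambda,\mu\in\Lambda r(x)$, $\lambda\ne\mu$ implies $\lambda x\neq\mu x$. $\Lambda$ is aperiodic if for each $v\in\Lambda^0$ there is an aperiodic boundary path $x$ with $r(x)=v$. A topological groupoid $\mathcal{G}$ with unit space $\mathcal{G}^{(0)}$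 is effective if the interior of $\operatorname{Iso}(\mathcal{G}):=\{a\in\mathcal{G}:s(a)=r(a)\}$ is $\mathcal{G}^{(0)}$. *)

theory Defs
  imports "HOL-Analysis.Analysis" "HOL-Library.Function_Algebras" "HOL-Library.Extended_Nat"
begin

text \<open>
  The rank \<open>k \<ge> 1\<close> is the cardinality of the finite type \<open>'k\<close>. Elements of \<open>\<nat>\<^sup>k\<close>, \<open>(\<nat> \<union> {\<infinity>})\<^sup>k\<close> and
  \<open>\<int>\<^sup>k\<close> are functions on \<open>'k\<close>, with the pointwise order, \<^term>\<open>sup\<close>, \<open>+\<close> and \<open>-\<close> of the library.
  Subtraction on \<open>\<nat>\<close> truncates; it is applied below only to \<open>p \<le> q\<close>.
\<close>

abbreviation env :: "('k \<Rightarrow> nat) \<Rightarrow> 'k \<Rightarrow> enat" where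
  "env n \<equiv> \<lambda>i. enat (n i)"

abbreviation intv :: "('k \<Rightarrow> nat) \<Rightarrow> 'k \<Rightarrow> int" where
  "intv n \<equiv> \<lambda>i. int (n i)"


section \<open>k-graphs\<close>

text \<open>
  Objects are identified with identity morphisms, so \<open>rng\<close> and \<open>src\<close> are morphism-valued.
  \<open>cmp \<Lambda> \<alpha> \<beta>\<close> is the composite \<open>\<alpha>\<beta>\<close>, meaningful when \<open>src \<Lambda> \<alpha> = rng \<Lambda> \<beta>\<close>.
\<close>

record ('a, 'k) kgraph_data =
  mor :: "'a set"
  rng :: "'a \<Rightarrow> 'a"
  src :: "'a \<Rightarrow> 'a"
  cmp :: "'a \<Rightarrow> 'a \<Rightarrow> 'a"
  deg :: "'a \<Rightarrow> 'k \<Rightarrow> nat"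

locale k_graph =
  fixes \<Lambda> :: "('a, 'k::finite) kgraph_data"
  assumes rng_mor: "\<alpha> \<in> mor \<Lambda> \<Longrightarrow> rng \<Lambda> \<alpha> \<in> mor \<Lambda>"
    and src_mor: "\<alpha> \<in> mor \<Lambda> \<Longrightarrow> src \<Lambda> \<alpha> \<in> mor \<Lambda>"
    and rng_rng: "\<alpha> \<in> mor \<Lambda> \<Longrightarrow> rng \<Lambda> (rng \<Lambda> \<alpha>) = rng \<Lambda> \<alpha>"
    and src_rng: "\<alpha> \<in> mor \<Lambda> \<Longrightarrow> src \<Lambda> (rng \<Lambda> \<alpha>) = rng \<Lambda> \<alpha>"
    and rng_src: "\<alpha> \<in> mor \<Lambda> \<Longrightarrow> rng \<Lambda> (src \<Lambda> \<alpha>) = src \<Lambda> \<alpha>"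
    and src_src: "\<alpha> \<in> mor \<Lambda> \<Longrightarrow> src \<Lambda> (src \<Lambda> \<alpha>) = src \<Lambda> \<alpha>"
    and cmp_mor: "\<lbrakk>\<alpha> \<in> mor \<Lambda>; \<beta> \<in> mor \<Lambda>; src \<Lambda> \<alpha> = rng \<Lambda> \<beta>\<rbrakk> \<Longrightarrow> cmp \<Lambda> \<alpha> \<beta> \<in> mor \<Lambda>"
    and rng_cmp: "\<lbrakk>\<alpha> \<in> mor \<Lambda>; \<beta> \<in> mor \<Lambda>; src \<Lambda> \<alpha> = rng \<Lambda> \<beta>\<rbrakk> \<Longrightarrow> rng \<Lambda> (cmp \<Lambda> \<alpha> \<beta>) = rng \<Lambda> \<alpha>"
    and src_cmp: "\<lbrakk>\<alpha> \<in> mor \<Lambda>; \<beta> \<in> mor \<Lambda>; src \<Lambda> \<alpha> = rng \<Lambda> \<beta>\<rbrakk> \<Longrightarrow> src \<Lambda> (cmp \<Lambda> \<alpha> \<beta>) = src \<Lambda> \<beta>"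
    and cmp_assoc: "\<lbrakk>\<alpha> \<in> mor \<Lambda>; \<beta> \<in> mor \<Lambda>; \<nu> \<in> mor \<Lambda>; src \<Lambda> \<alpha> = rng \<Lambda> \<beta>; src \<Lambda> \<beta> = rng \<Lambda> \<nu>\<rbrakk>
      \<Longrightarrow> cmp \<Lambda> (cmp \<Lambda> \<alpha> \<beta>) \<nu> = cmp \<Lambda> \<alpha> (cmp \<Lambda> \<beta> \<nu>)"
    and id_left: "\<alpha> \<in> mor \<Lambda> \<Longrightarrow> cmp \<Lambda> (rng \<Lambda> \<alpha>) \<alpha> = \<alpha>"
    and id_right: "\<alpha> \<in> mor \<Lambda> \<Longrightarrow> cmp \<Lambda> \<alpha> (src \<Lambda> \<alpha>) = \<alpha>"
    and countable_mor: "countable (mor \<Lambda>)"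
    and deg_id: "\<alpha> \<in> mor \<Lambda> \<Longrightarrow> deg \<Lambda> (rng \<Lambda> \<alpha>) = 0" "\<alpha> \<in> mor \<Lambda> \<Longrightarrow> deg \<Lambda> (src \<Lambda> \<alpha>) = 0"
    and deg_cmp: "\<lbrakk>\<alpha> \<in> mor \<Lambda>; \<beta> \<in> mor \<Lambda>; src \<Lambda> \<alpha> = rng \<Lambda> \<beta>\<rbrakk>
      \<Longrightarrow> deg \<Lambda> (cmp \<Lambda> \<alpha> \<beta>) = deg \<Lambda> \<alpha> + deg \<Lambda> \<beta>"
    and factorisation: "\<lbrakk>\<alpha> \<in> mor \<Lambda>; deg \<Lambda> \<alpha> = m + n\<rbrakk> \<Longrightarrow>
      \<exists>!(\<beta>, \<nu>). \<beta> \<in> mor \<Lambda> \<and> \<nu> \<in> mor \<Lambda> \<and> src \<Lambda> \<beta> = rng \<Lambda> \<nu> \<and>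
        \<alpha> = cmp \<Lambda> \<beta> \<nu> \<and> deg \<Lambda> \<beta> = m \<and> deg \<Lambda> \<nu> = n"

definition verts :: "('a, 'k) kgraph_data \<Rightarrow> 'a set" where
  "verts \<Lambda> = {v \<in> mor \<Lambda>. deg \<Lambda> v = 0}"

text \<open>The morphisms of degree zero are exactly the identity morphisms.\<close>

lemma (in k_graph) verts_eq_identities:
  "verts \<Lambda> = rng \<Lambda> ` mor \<Lambda>" "verts \<Lambda> = src \<Lambda> ` mor \<Lambda>"
proof -
  have *: "rng \<Lambda> v = v \<and> src \<Lambda> v = v" if v: "v \<in> verts \<Lambda>" for v
  proof -
    have m: "v \<in> mor \<Lambda>" "deg \<Lambda> v = 0 + 0"
      using v by (auto simp: verts_def)
    let ?P = "\<lambda>(\<beta>, \<nu>). \<beta> \<in> mor \<Lambda> \<and> \<nu> \<in> mor \<Lambda> \<and> src \<Lambda> \<beta> = rng \<Lambda> \<nu> \<and>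
        v = cmp \<Lambda> \<beta> \<nu> \<and> deg \<Lambda> \<beta> = 0 \<and> deg \<Lambda> \<nu> = 0"
    have "?P (rng \<Lambda> v, v)" "?P (v, src \<Lambda> v)"
      using m by (auto simp: rng_mor src_mor rng_src src_rng id_left id_right deg_id)
    then have "(rng \<Lambda> v, v) = (v, src \<Lambda> v)"
      using factorisation[OF m] by blast
    then show ?thesis by simp
  qed
  show "verts \<Lambda> = rng \<Lambda> ` mor \<Lambda>"
    using * by (force simp: verts_def rng_mor deg_id)
  show "verts \<Lambda> = src \<Lambda> ` mor \<Lambda>"
    using * by (force simp: verts_def src_mor deg_id)
qed

definition out_of :: "('a, 'k) kgraph_data \<Rightarrow> 'a \<Rightarrow> 'a set" \<comment> \<open>\<open>v\<Lambda>\<close>\<close> where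
  "out_of \<Lambda> v = {\<alpha> \<in> mor \<Lambda>. rng \<Lambda> \<alpha> = v}"

definition into :: "('a, 'k) kgraph_data \<Rightarrow> 'a \<Rightarrow> 'a set" \<comment> \<open>\<open>\<Lambda>v\<close>\<close> where
  "into \<Lambda> v = {\<alpha> \<in> mor \<Lambda>. src \<Lambda> \<alpha> = v}"

definition initial_seg :: "('a, 'k) kgraph_data \<Rightarrow> 'a \<Rightarrow> ('k \<Rightarrow> nat) \<Rightarrow> 'a"
  \<comment> \<open>\<open>\<alpha>(0,m)\<close> for \<open>m \<le> d(\<alpha>)\<close>\<close> where
  "initial_seg \<Lambda> \<alpha> m = (THE \<beta>. \<beta> \<in> mor \<Lambda> \<and> deg \<Lambda> \<beta> = m \<and>
     (\<exists>\<nu>\<in>mor \<Lambda>. src \<Lambda> \<beta> = rng \<Lambda> \<nu> \<and> \<alpha> = cmp \<Lambda> \<beta> \<nu>))"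

definition MCE :: "('a, 'k) kgraph_data \<Rightarrow> 'a \<Rightarrow> 'a \<Rightarrow> 'a set" where
  "MCE \<Lambda> \<alpha> \<beta> = {\<tau> \<in> mor \<Lambda>. deg \<Lambda> \<tau> = sup (deg \<Lambda> \<alpha>) (deg \<Lambda> \<beta>) \<and>
     initial_seg \<Lambda> \<tau> (deg \<Lambda> \<alpha>) = \<alpha> \<and> initial_seg \<Lambda> \<tau> (deg \<Lambda> \<beta>) = \<beta>}"

definition Lmin :: "('a, 'k) kgraph_data \<Rightarrow> 'a \<Rightarrow> 'a \<Rightarrow> ('a \<times> 'a) set" where
  "Lmin \<Lambda> \<alpha> \<beta> = {(\<rho>, \<tau>) \<in> mor \<Lambda> \<times> mor \<Lambda>. src \<Lambda> \<alpha> = rng \<Lambda> \<rho> \<and> src \<Lambda> \<beta> = rng \<Lambda> \<tau> \<and>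
     cmp \<Lambda> \<alpha> \<rho> = cmp \<Lambda> \<beta> \<tau> \<and> cmp \<Lambda> \<alpha> \<rho> \<in> MCE \<Lambda> \<alpha> \<beta>}"

definition finitely_aligned :: "('a, 'k) kgraph_data \<Rightarrow> bool" where
  "finitely_aligned \<Lambda> \<longleftrightarrow> (\<forall>\<alpha>\<in>mor \<Lambda>. \<forall>\<beta>\<in>mor \<Lambda>. finite (Lmin \<Lambda> \<alpha> \<beta>))"

definition exhaustive :: "('a, 'k) kgraph_data \<Rightarrow> 'a \<Rightarrow> 'a set \<Rightarrow> bool" where
  "exhaustive \<Lambda> v E \<longleftrightarrow> E \<subseteq> out_of \<Lambda> v \<and> (\<forall>\<alpha>\<in>out_of \<Lambda> v. \<exists>\<beta>\<in>E. Lmin \<Lambda> \<alpha> \<beta> \<noteq> {})"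

definition FE :: "('a, 'k) kgraph_data \<Rightarrow> 'a \<Rightarrow> 'a set set"
  \<comment> \<open>the members \<open>E\<close> of \<open>FE(\<Lambda>)\<close> with \<open>r(E) = v\<close>\<close> where
  "FE \<Lambda> v = {E. v \<in> verts \<Lambda> \<and> finite E \<and> E \<subseteq> out_of \<Lambda> v - {v} \<and> exhaustive \<Lambda> v E}"


section \<open>Boundary paths\<close>

definition Omega :: "('k \<Rightarrow> enat) \<Rightarrow> (('k \<Rightarrow> nat) \<times> ('k \<Rightarrow> nat), 'k) kgraph_data" where
  "Omega m = \<lparr>mor = {(p, q). p \<le> q \<and> env q \<le> m},
     rng = \<lambda>(p, q). (p, p), src = \<lambda>(p, q). (q, q),
     cmp = \<lambda>(p, q) (q', t). (p, t), deg = \<lambda>(p, q). q - p\<rparr>"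

lemma k_graph_Omega: "k_graph (Omega (m :: 'k::finite \<Rightarrow> enat))"
proof unfold_locales
  fix \<alpha> :: "('k \<Rightarrow> nat) \<times> ('k \<Rightarrow> nat)" and a b :: "'k \<Rightarrow> nat"
  assume l: "\<alpha> \<in> mor (Omega m)" and d: "deg (Omega m) \<alpha> = a + b"
  obtain p q where pq: "\<alpha> = (p, q)" "p \<le> q" "env q \<le> m"
    using l by (auto simp: Omega_def)
  have q: "q = p + a + b"
  proof
    fix i
    have "q i - p i = a i + b i" "p i \<le> q i"
      using d pq by (auto simp: Omega_def fun_eq_iff le_fun_def)
    then show "q i = (p + a + b) i" by simp
  qed
  have "env (p + a) \<le> env q"
    by (auto simp: q le_fun_def)
  then have "env (p + a) \<le> m"
    using pq(3) by (rule order_trans)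
  have cut: "v = p + a" if "p \<le> v" "v - p = a" for v
  proof
    fix i
    have "p i \<le> v i" "v i - p i = a i"
      using that by (auto simp: fun_eq_iff le_fun_def)
    then show "v i = (p + a) i" by simp
  qed
  let ?P = "\<lambda>(\<beta>, \<nu>). \<beta> \<in> mor (Omega m) \<and> \<nu> \<in> mor (Omega m) \<and>
      src (Omega m) \<beta> = rng (Omega m) \<nu> \<and> \<alpha> = cmp (Omega m) \<beta> \<nu> \<and>
      deg (Omega m) \<beta> = a \<and> deg (Omega m) \<nu> = b"
  show "\<exists>!x. ?P x"
  proof (rule ex1I)
    show "?P ((p, p + a), (p + a, q))"
      using \<open>env (p + a) \<le> m\<close> pq(1,3) q by (simp add: Omega_def le_fun_def fun_eq_iff)
    fix x assume "?P x"
    then show "x = ((p, p + a), (p + a, q))"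
      using pq(1) cut by (cases x) (auto simp: Omega_def)
  qed
qed (auto simp: Omega_def le_fun_def fun_eq_iff, (meson enat_ord_simps(1) order_trans)+)

definition kgraph_functor ::
  "('a, 'k) kgraph_data \<Rightarrow> ('b, 'k) kgraph_data \<Rightarrow> ('a \<Rightarrow> 'b) \<Rightarrow> bool" where
  "kgraph_functor \<Gamma> \<Lambda> f \<longleftrightarrow> f \<in> mor \<Gamma> \<rightarrow> mor \<Lambda> \<and>
     (\<forall>a\<in>mor \<Gamma>. f (rng \<Gamma> a) = rng \<Lambda> (f a) \<and> f (src \<Gamma> a) = src \<Lambda> (f a) \<and>
        deg \<Lambda> (f a) = deg \<Gamma> a) \<and>
     (\<forall>a\<in>mor \<Gamma>. \<forall>b\<in>mor \<Gamma>. src \<Gamma> a = rng \<Gamma> b \<longrightarrow> f (cmp \<Gamma> a b) = cmp \<Lambda> (f a) (f b))"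

text \<open>
  A path \<open>x : \<Omega>\<^bsub>k,m\<^esub> \<rightarrow> \<Lambda>\<close> is the pair of its degree \<open>m\<close> and its action on morphisms. The latter is
  extensional on \<open>mor (Omega m)\<close>, so that equality of pairs is equality of functors.
\<close>

type_synonym ('a, 'k) kpath = "('k \<Rightarrow> enat) \<times> (('k \<Rightarrow> nat) \<times> ('k \<Rightarrow> nat) \<Rightarrow> 'a)"

abbreviation pdeg :: "('a, 'k) kpath \<Rightarrow> 'k \<Rightarrow> enat" where
  "pdeg x \<equiv> fst x"

abbreviation pval :: "('a, 'k) kpath \<Rightarrow> ('k \<Rightarrow> nat) \<Rightarrow> ('k \<Rightarrow> nat) \<Rightarrow> 'a" where
  "pval x p q \<equiv> snd x (p, q)"

abbreviation prng :: "('a, 'k) kpath \<Rightarrow> 'a" where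
  "prng x \<equiv> pval x 0 0"

definition boundary_paths :: "('a, 'k) kgraph_data \<Rightarrow> ('a, 'k) kpath set" where
  "boundary_paths \<Lambda> = {x.
     snd x \<in> extensional (mor (Omega (pdeg x))) \<and>
     kgraph_functor (Omega (pdeg x)) \<Lambda> (snd x) \<and>
     (\<forall>n. env n \<le> pdeg x \<longrightarrow> (\<forall>E \<in> FE \<Lambda> (pval x n n).
        \<exists>\<alpha>\<in>E. env (n + deg \<Lambda> \<alpha>) \<le> pdeg x \<and> pval x n (n + deg \<Lambda> \<alpha>) = \<alpha>))}"

definition shift :: "('k \<Rightarrow> nat) \<Rightarrow> ('a, 'k) kpath \<Rightarrow> ('a, 'k) kpath"
  \<comment> \<open>\<open>\<sigma>\<^sup>n x\<close> for \<open>n \<le> d(x)\<close>; note \<open>\<infinity> - n = \<infinity>\<close> in \<open>enat\<close>\<close> where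
  "shift n x = (let m = pdeg x - env n in
     (m, restrict (\<lambda>(p, q). pval x (n + p) (n + q)) (mor (Omega m))))"

definition prepend :: "('a, 'k) kgraph_data \<Rightarrow> 'a \<Rightarrow> ('a, 'k) kpath \<Rightarrow> ('a, 'k) kpath"
  \<comment> \<open>\<open>\<alpha>x\<close> for \<open>s(\<alpha>) = r(x)\<close>\<close> where
  "prepend \<Lambda> \<alpha> x = (THE y. y \<in> boundary_paths \<Lambda> \<and> env (deg \<Lambda> \<alpha>) \<le> pdeg y \<and>
     pval y 0 (deg \<Lambda> \<alpha>) = \<alpha> \<and> shift (deg \<Lambda> \<alpha>) y = x)"

definition boundary_paths_at :: "('a, 'k) kgraph_data \<Rightarrow> 'a \<Rightarrow> ('a, 'k) kpath set"
  \<comment> \<open>\<open>v\<partial>\<Lambda>\<close>\<close> where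
  "boundary_paths_at \<Lambda> v = {x \<in> boundary_paths \<Lambda>. prng x = v}"

definition aperiodic_path :: "('a, 'k) kgraph_data \<Rightarrow> ('a, 'k) kpath \<Rightarrow> bool" where
  "aperiodic_path \<Lambda> x \<longleftrightarrow> (\<forall>\<alpha>\<in>into \<Lambda> (prng x). \<forall>\<beta>\<in>into \<Lambda> (prng x).
     \<alpha> \<noteq> \<beta> \<longrightarrow> prepend \<Lambda> \<alpha> x \<noteq> prepend \<Lambda> \<beta> x)"

definition aperiodic :: "('a, 'k) kgraph_data \<Rightarrow> bool" where
  "aperiodic \<Lambda> \<longleftrightarrow> (\<forall>v\<in>verts \<Lambda>. \<exists>x\<in>boundary_paths_at \<Lambda> v. aperiodic_path \<Lambda> x)"


section \<open>Groupoids with a topology\<close>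

text \<open>
  Units are identified with their identity arrows, so \<open>grng\<close> and \<open>gsrc\<close> are arrow-valued and the
  unit space is a set of arrows.
\<close>

record 'g top_groupoid =
  arr :: "'g set"
  grng :: "'g \<Rightarrow> 'g"
  gsrc :: "'g \<Rightarrow> 'g"
  gmul :: "'g \<Rightarrow> 'g \<Rightarrow> 'g"
  ginv :: "'g \<Rightarrow> 'g"
  gtop :: "'g topology"

definition unit_space :: "'g top_groupoid \<Rightarrow> 'g set" where
  "unit_space G = gsrc G ` arr G"

definition Iso :: "'g top_groupoid \<Rightarrow> 'g set" where
  "Iso G = {a \<in> arr G. gsrc G a = grng G a}"

definition effective :: "'g top_groupoid \<Rightarrow> bool" where
  "effective G \<longleftrightarrow> gtop G interior_of Iso G = unit_space G"


section \<open>The boundary-path groupoid\<close>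

type_synonym ('a, 'k) bp_arrow = "('a, 'k) kpath \<times> ('k \<Rightarrow> int) \<times> ('a, 'k) kpath"

definition bp_arrows :: "('a, 'k) kgraph_data \<Rightarrow> ('a, 'k) bp_arrow set" where
  "bp_arrows \<Lambda> = {(prepend \<Lambda> \<alpha> z, intv (deg \<Lambda> \<alpha>) - intv (deg \<Lambda> \<beta>), prepend \<Lambda> \<beta> z) | \<alpha> \<beta> z.
     \<alpha> \<in> mor \<Lambda> \<and> \<beta> \<in> mor \<Lambda> \<and> src \<Lambda> \<alpha> = src \<Lambda> \<beta> \<and> z \<in> boundary_paths_at \<Lambda> (src \<Lambda> \<alpha>)}"

definition Zpath :: "('a, 'k) kgraph_data \<Rightarrow> 'a \<Rightarrow> ('a, 'k) kpath set"
  \<comment> \<open>\<open>Z(\<alpha>) = \<alpha>\<partial>\<Lambda>\<close>\<close> where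
  "Zpath \<Lambda> \<alpha> = prepend \<Lambda> \<alpha> ` boundary_paths_at \<Lambda> (src \<Lambda> \<alpha>)"

definition Zpair :: "('a, 'k) kgraph_data \<Rightarrow> 'a \<Rightarrow> 'a \<Rightarrow> ('a, 'k) bp_arrow set"
  \<comment> \<open>\<open>Z(\<alpha> *\<^sub>s \<beta>)\<close>\<close> where
  "Zpair \<Lambda> \<alpha> \<beta> = {(x, m, y) \<in> bp_arrows \<Lambda>. m = intv (deg \<Lambda> \<alpha>) - intv (deg \<Lambda> \<beta>) \<and>
     x \<in> Zpath \<Lambda> \<alpha> \<and> y \<in> Zpath \<Lambda> \<beta> \<and> shift (deg \<Lambda> \<alpha>) x = shift (deg \<Lambda> \<beta>) y}"

definition Zminus :: "('a, 'k) kgraph_data \<Rightarrow> 'a \<Rightarrow> 'a \<Rightarrow> 'a set \<Rightarrow> ('a, 'k) bp_arrow set"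
  \<comment> \<open>\<open>Z(\<alpha> *\<^sub>s \<beta> \ G)\<close>\<close> where
  "Zminus \<Lambda> \<alpha> \<beta> G = Zpair \<Lambda> \<alpha> \<beta> - (\<Union>\<nu>\<in>G. Zpair \<Lambda> (cmp \<Lambda> \<alpha> \<nu>) (cmp \<Lambda> \<beta> \<nu>))"

definition bp_basis :: "('a, 'k) kgraph_data \<Rightarrow> ('a, 'k) bp_arrow set set" where
  "bp_basis \<Lambda> = {Zminus \<Lambda> \<alpha> \<beta> G | \<alpha> \<beta> G.
     \<alpha> \<in> mor \<Lambda> \<and> \<beta> \<in> mor \<Lambda> \<and> src \<Lambda> \<alpha> = src \<Lambda> \<beta> \<and>
     finite G \<and> G \<subseteq> out_of \<Lambda> (src \<Lambda> \<alpha>) \<and> \<not> exhaustive \<Lambda> (src \<Lambda> \<alpha>) G}"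

text \<open>
  For finitely aligned \<open>\<Lambda>\<close> the family \<open>bp_basis \<Lambda>\<close> is a basis, so the topology it generates
  is the one whose open sets are the unions of its members.
\<close>

definition boundary_path_groupoid ::
  "('a, 'k) kgraph_data \<Rightarrow> ('a, 'k) bp_arrow top_groupoid" where
  "boundary_path_groupoid \<Lambda> = \<lparr>arr = bp_arrows \<Lambda>,
     grng = \<lambda>(x, m, y). (x, 0, x), gsrc = \<lambda>(x, m, y). (y, 0, y),
     gmul = \<lambda>(x, m, y) (y', n, w). (x, m + n, w), ginv = \<lambda>(x, m, y). (y, - m, x),
     gtop = topology_generated_by (bp_basis \<Lambda>)\<rparr>"

end

theory Submission
  imports Defs
begin

text \<open>
  A path \<open>x\<close> is determined by the set of its initial segments \<open>x(0,n)\<close>, and the sets that arise are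
  exactly the directed sets of morphisms closed under prefixes. In these terms \<open>x\<close> is a boundary path
  iff for each initial segment \<open>\<phi>\<close> and each \<open>E \<in> FE(\<Lambda>)\<close> with \<open>r(E) = s(\<phi>)\<close> some \<open>\<phi>\<beta>\<close> with \<open>\<beta> \<in> E\<close> is
  again an initial segment.

  If \<open>\<Lambda>\<close> is aperiodic and an arrow \<open>(\<alpha>z, m, \<beta>z)\<close> lies in the interior of the isotropy, then by
  continuity and finite alignment there is \<open>\<mu>\<close> with \<open>\<alpha>\<mu>w = \<beta>\<mu>w\<close> for all \<open>w\<close>; an aperiodic \<open>w\<close> gives
  \<open>\<alpha>\<mu> = \<beta>\<mu>\<close>, so \<open>\<alpha> = \<beta>\<close> and the arrow is a unit.

  Conversely, suppose that the groupoid is effective and \<open>\<alpha> \<noteq> \<beta>\<close> have the same source \<open>v\<close>. No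
  \<open>Z(\<alpha>\<mu> *\<^sub>s \<beta>\<mu>)\<close> consists of isotropy, so every \<open>\<mu>\<close> extends to some \<open>\<eta>\<close> with \<open>\<alpha>y \<noteq> \<beta>y\<close> for all boundary
  paths \<open>y\<close> starting with \<open>\<eta>\<close>. A Baire category argument over the countably many pairs \<open>(\<alpha>, \<beta>)\<close>, carried
  out by hand along an increasing sequence of morphisms that also meets all the conditions for a boundary
  path, yields an aperiodic boundary path with range \<open>v\<close>.
\<close>

text \<open>\<open>cmp\<close> is a total function, and the category laws hold only for morphisms
  with matching ends. Bundling these side conditions lets the laws be chained.\<close>

definition composable :: "('a, 'k) kgraph_data \<Rightarrow> 'a \<Rightarrow> 'a \<Rightarrow> bool" where
  "composable \<Lambda> \<alpha> \<beta> \<longleftrightarrow> \<alpha> \<in> mor \<Lambda> \<and> \<beta> \<in> mor \<Lambda> \<and> src \<Lambda> \<alpha> = rng \<Lambda> \<beta>"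

text \<open>The relation \<alpha> = \<phi>(0, d(\<alpha>)), phrased as the existence of a
  complementary factor so that no definite description has to be handled.\<close>

definition prefix_of :: "('a, 'k) kgraph_data \<Rightarrow> 'a \<Rightarrow> 'a \<Rightarrow> bool" where
  "prefix_of \<Lambda> \<alpha> \<phi> \<longleftrightarrow> (\<exists>\<nu>. composable \<Lambda> \<alpha> \<nu> \<and> \<phi> = cmp \<Lambda> \<alpha> \<nu>)"

section \<open>Arithmetic of degrees, finite and extended\<close>

lemma le_imp_add_diff: "m \<le> n \<Longrightarrow> n = m + (n - m)" for m n :: "'k \<Rightarrow> nat"
  by (auto simp: le_fun_def fun_eq_iff)

lemma le_add_fun: "m \<le> m + n" for m n :: "'k \<Rightarrow> nat"
  by (auto simp: le_fun_def)

lemma add_left_cancel_fun: "m + n = m + n' \<longleftrightarrow> n = n'" for m n :: "'k \<Rightarrow> nat"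
  by (auto simp: fun_eq_iff)

lemma add_left_mono_fun: "m + n \<le> m + n' \<longleftrightarrow> n \<le> n'" for m n :: "'k \<Rightarrow> nat"
  by (auto simp: le_fun_def)

lemma env_le_trans: "p \<le> q \<Longrightarrow> env q \<le> m \<Longrightarrow> env p \<le> m"
  by (meson enat_ord_simps(1) le_fun_def order_trans)

lemma zero_le_fun: "(0 :: 'b \<Rightarrow> nat) \<le> q"
  by (simp add: le_fun_def)

lemma env_sup_le: "env p \<le> m \<Longrightarrow> env q \<le> m \<Longrightarrow> env (sup p q) \<le> m"
  by (auto simp: le_fun_def sup_max max_def)

text \<open>Coordinatewise: at an infinite coordinate of m both sides hold, and at a finite one n
  \<le> m makes the truncated subtraction a true one.\<close>

lemma env_le_minus_iff: "env n \<le> m \<Longrightarrow> env q \<le> m - env n \<longleftrightarrow> env (n + q) \<le> m"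
proof -
  assume n: "env n \<le> m"
  have "enat (q i) \<le> m i - enat (n i) \<longleftrightarrow> enat (n i + q i) \<le> m i" for i
    using le_funD[OF n, of i] by (cases "m i") auto
  then show ?thesis by (simp add: le_fun_def)
qed

lemma mor_Omega: "(p, q) \<in> mor (Omega m) \<longleftrightarrow> p \<le> q \<and> env q \<le> m"
  by (simp add: Omega_def)


section \<open>Prefixes and minimal common extensions\<close>

context k_graph
begin

abbreviation comp_mor (infixl "\<cdot>" 70) where
  "\<alpha> \<cdot> \<beta> \<equiv> cmp \<Lambda> \<alpha> \<beta>"

abbreviation pfx (infix "\<preceq>" 50) where
  "\<alpha> \<preceq> \<phi> \<equiv> prefix_of \<Lambda> \<alpha> \<phi>"

abbreviation composab (infix "\<bowtie>" 50) where
  "\<alpha> \<bowtie> \<beta> \<equiv> composable \<Lambda> \<alpha> \<beta>"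

lemma composableI: "\<alpha> \<in> mor \<Lambda> \<Longrightarrow> \<beta> \<in> mor \<Lambda> \<Longrightarrow> src \<Lambda> \<alpha> = rng \<Lambda> \<beta> \<Longrightarrow> \<alpha> \<bowtie> \<beta>"
  by (simp add: composable_def)

lemma composableD:
  assumes "\<alpha> \<bowtie> \<beta>"
  shows "\<alpha> \<in> mor \<Lambda>" "\<beta> \<in> mor \<Lambda>" "src \<Lambda> \<alpha> = rng \<Lambda> \<beta>" "\<alpha> \<cdot> \<beta> \<in> mor \<Lambda>"
    "rng \<Lambda> (\<alpha> \<cdot> \<beta>) = rng \<Lambda> \<alpha>" "src \<Lambda> (\<alpha> \<cdot> \<beta>) = src \<Lambda> \<beta>" "deg \<Lambda> (\<alpha> \<cdot> \<beta>) = deg \<Lambda> \<alpha> + deg \<Lambda> \<beta>"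
  using assms by (auto simp: composable_def cmp_mor rng_cmp src_cmp deg_cmp)

lemma composable_assoc:
  assumes "\<alpha> \<bowtie> \<beta>" "\<beta> \<bowtie> \<nu>"
  shows "\<alpha> \<cdot> \<beta> \<bowtie> \<nu>" "\<alpha> \<bowtie> \<beta> \<cdot> \<nu>" "\<alpha> \<cdot> \<beta> \<cdot> \<nu> = \<alpha> \<cdot> (\<beta> \<cdot> \<nu>)"
  using assms by (auto simp: composable_def cmp_mor rng_cmp src_cmp cmp_assoc)

lemma composable_cmp_left: "\<alpha> \<bowtie> \<beta> \<Longrightarrow> \<alpha> \<cdot> \<beta> \<bowtie> \<nu> \<longleftrightarrow> \<beta> \<bowtie> \<nu>"
  by (auto simp: composable_def cmp_mor src_cmp)

lemma composable_src: "\<alpha> \<in> mor \<Lambda> \<Longrightarrow> \<alpha> \<bowtie> src \<Lambda> \<alpha>"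
  by (simp add: composable_def rng_src src_mor)

lemma vertsD:
  assumes "v \<in> verts \<Lambda>"
  shows "v \<in> mor \<Lambda>" "deg \<Lambda> v = 0" "rng \<Lambda> v = v" "src \<Lambda> v = v"
proof -
  show "v \<in> mor \<Lambda>" "deg \<Lambda> v = 0" using assms by (auto simp: verts_def)
  show "rng \<Lambda> v = v" using assms verts_eq_identities(1) rng_rng by auto
  show "src \<Lambda> v = v" using assms verts_eq_identities(2) src_src by auto
qed

lemma src_in_verts: "\<alpha> \<in> mor \<Lambda> \<Longrightarrow> src \<Lambda> \<alpha> \<in> verts \<Lambda>"
  and rng_in_verts: "\<alpha> \<in> mor \<Lambda> \<Longrightarrow> rng \<Lambda> \<alpha> \<in> verts \<Lambda>"
  by (simp_all add: verts_def src_mor rng_mor deg_id)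

text \<open>Cancellation in the degrees forces the second factors to have equal degree as well, so
  both pairs factorise one morphism along one splitting of its degree.\<close>

lemma factorisation_unique:
  assumes "\<alpha> \<bowtie> \<nu>" "\<beta> \<bowtie> \<xi>" "\<alpha> \<cdot> \<nu> = \<beta> \<cdot> \<xi>" "deg \<Lambda> \<alpha> = deg \<Lambda> \<beta>"
  shows "\<alpha> = \<beta>" "\<nu> = \<xi>"
proof -
  have dn: "deg \<Lambda> \<nu> = deg \<Lambda> \<xi>"
    using assms composableD(7) by (metis add_left_cancel_fun)
  let ?P = "\<lambda>(\<beta>', \<nu>'). \<beta>' \<in> mor \<Lambda> \<and> \<nu>' \<in> mor \<Lambda> \<and> src \<Lambda> \<beta>' = rng \<Lambda> \<nu>' \<and>
      \<alpha> \<cdot> \<nu> = \<beta>' \<cdot> \<nu>' \<and> deg \<Lambda> \<beta>' = deg \<Lambda> \<alpha> \<and> deg \<Lambda> \<nu>' = deg \<Lambda> \<nu>"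
  have "\<exists>!p. ?P p"
    by (rule factorisation[OF composableD(4,7)[OF assms(1)]])
  moreover have "?P (\<alpha>, \<nu>)" "?P (\<beta>, \<xi>)"
    using assms composableD[OF assms(1)] composableD[OF assms(2)] dn by simp_all
  ultimately have "(\<alpha>, \<nu>) = (\<beta>, \<xi>)" by blast
  then show "\<alpha> = \<beta>" "\<nu> = \<xi>" by auto
qed

lemma cmp_left_cancel: "\<alpha> \<bowtie> \<nu> \<Longrightarrow> \<alpha> \<bowtie> \<xi> \<Longrightarrow> \<alpha> \<cdot> \<nu> = \<alpha> \<cdot> \<xi> \<longleftrightarrow> \<nu> = \<xi>"
  using factorisation_unique(2) by blast

lemma cmp_right_cancel:
  assumes "\<alpha> \<bowtie> \<nu>" "\<beta> \<bowtie> \<nu>" "\<alpha> \<cdot> \<nu> = \<beta> \<cdot> \<nu>"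
  shows "\<alpha> = \<beta>"
proof (rule factorisation_unique(1)[OF assms])
  have "deg \<Lambda> \<alpha> + deg \<Lambda> \<nu> = deg \<Lambda> \<beta> + deg \<Lambda> \<nu>"
    using assms composableD(7) by metis
  then show "deg \<Lambda> \<alpha> = deg \<Lambda> \<beta>" by (simp add: fun_eq_iff)
qed

lemma prefixI: "\<alpha> \<bowtie> \<nu> \<Longrightarrow> \<alpha> \<preceq> \<alpha> \<cdot> \<nu>"
  by (auto simp: prefix_of_def)

lemma prefixE:
  assumes "\<alpha> \<preceq> \<phi>"
  obtains \<nu> where "\<alpha> \<bowtie> \<nu>" "\<phi> = \<alpha> \<cdot> \<nu>"
  using assms by (auto simp: prefix_of_def)

lemma prefixD:
  assumes "\<alpha> \<preceq> \<phi>"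
  shows "\<alpha> \<in> mor \<Lambda>" "\<phi> \<in> mor \<Lambda>" "rng \<Lambda> \<alpha> = rng \<Lambda> \<phi>" "deg \<Lambda> \<alpha> \<le> deg \<Lambda> \<phi>"
  using assms by (auto elim!: prefixE simp: composableD le_add_fun)

lemma prefix_refl: "\<alpha> \<in> mor \<Lambda> \<Longrightarrow> \<alpha> \<preceq> \<alpha>"
  using prefixI[OF composable_src] by (simp add: id_right)

lemma prefix_trans:
  assumes "\<alpha> \<preceq> \<beta>" "\<beta> \<preceq> \<phi>"
  shows "\<alpha> \<preceq> \<phi>"
proof -
  obtain \<nu> \<xi> where "\<alpha> \<bowtie> \<nu>" "\<beta> = \<alpha> \<cdot> \<nu>" "\<beta> \<bowtie> \<xi>" "\<phi> = \<beta> \<cdot> \<xi>"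
    using assms by (auto elim!: prefixE)
  then show ?thesis
    using composable_assoc[of \<alpha> \<nu> \<xi>] by (auto simp: composable_cmp_left intro: prefixI)
qed

lemma prefix_unique:
  assumes "\<alpha> \<preceq> \<phi>" "\<beta> \<preceq> \<phi>" "deg \<Lambda> \<alpha> = deg \<Lambda> \<beta>"
  shows "\<alpha> = \<beta>"
  using assms by (metis prefixE factorisation_unique(1))

lemma prefix_exists:
  assumes "\<phi> \<in> mor \<Lambda>" "m \<le> deg \<Lambda> \<phi>"
  obtains \<alpha> where "\<alpha> \<preceq> \<phi>" "deg \<Lambda> \<alpha> = m"
proof -
  obtain \<beta> \<nu> where "\<beta> \<in> mor \<Lambda>" "\<nu> \<in> mor \<Lambda>" "src \<Lambda> \<beta> = rng \<Lambda> \<nu>" "\<phi> = \<beta> \<cdot> \<nu>" "deg \<Lambda> \<beta> = m"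
    using factorisation[OF assms(1) le_imp_add_diff[OF assms(2)]] by auto
  then show ?thesis using that prefixI composableI by metis
qed

text \<open>The prefix of \<beta> of degree d(\<alpha>) is also a prefix of \<phi>, hence equal to
  \<alpha>.\<close>

lemma prefix_linear:
  assumes "\<alpha> \<preceq> \<phi>" "\<beta> \<preceq> \<phi>" "deg \<Lambda> \<alpha> \<le> deg \<Lambda> \<beta>"
  shows "\<alpha> \<preceq> \<beta>"
proof -
  obtain \<alpha>' where "\<alpha>' \<preceq> \<beta>" "deg \<Lambda> \<alpha>' = deg \<Lambda> \<alpha>"
    using prefix_exists assms prefixD by metis
  then show ?thesis using prefix_unique prefix_trans assms by metis
qed

lemma prefix_cmp_iff:
  assumes "\<alpha> \<bowtie> \<nu>" "\<alpha> \<bowtie> \<xi>"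
  shows "\<alpha> \<cdot> \<nu> \<preceq> \<alpha> \<cdot> \<xi> \<longleftrightarrow> \<nu> \<preceq> \<xi>"
proof
  assume "\<alpha> \<cdot> \<nu> \<preceq> \<alpha> \<cdot> \<xi>"
  then obtain \<zeta> where z: "\<alpha> \<cdot> \<nu> \<bowtie> \<zeta>" "\<alpha> \<cdot> \<xi> = \<alpha> \<cdot> \<nu> \<cdot> \<zeta>" by (rule prefixE)
  then have n: "\<nu> \<bowtie> \<zeta>" using assms composable_cmp_left by blast
  then have "\<alpha> \<cdot> \<xi> = \<alpha> \<cdot> (\<nu> \<cdot> \<zeta>)" "\<alpha> \<bowtie> \<nu> \<cdot> \<zeta>"
    using z assms composable_assoc by auto
  then have "\<xi> = \<nu> \<cdot> \<zeta>" using cmp_left_cancel assms by blast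
  then show "\<nu> \<preceq> \<xi>" using n prefixI by simp
next
  assume "\<nu> \<preceq> \<xi>"
  then obtain \<zeta> where z: "\<nu> \<bowtie> \<zeta>" "\<xi> = \<nu> \<cdot> \<zeta>" by (rule prefixE)
  then show "\<alpha> \<cdot> \<nu> \<preceq> \<alpha> \<cdot> \<xi>"
    using composable_assoc[OF assms(1) z(1)] prefixI by metis
qed

text \<open>Existence and uniqueness of prefixes of each degree below d(\<phi>) give the definite
  description its meaning. This is the bridge from \<open>MCE\<close> to prefixes.\<close>

lemma initial_seg_eq_iff:
  assumes "\<phi> \<in> mor \<Lambda>" "m \<le> deg \<Lambda> \<phi>"
  shows "initial_seg \<Lambda> \<phi> m = \<alpha> \<longleftrightarrow> \<alpha> \<preceq> \<phi> \<and> deg \<Lambda> \<alpha> = m"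
proof -
  have *: "(\<beta> \<in> mor \<Lambda> \<and> deg \<Lambda> \<beta> = m \<and> (\<exists>\<nu>\<in>mor \<Lambda>. src \<Lambda> \<beta> = rng \<Lambda> \<nu> \<and> \<phi> = \<beta> \<cdot> \<nu>)) \<longleftrightarrow>
    \<beta> \<preceq> \<phi> \<and> deg \<Lambda> \<beta> = m" for \<beta>
    by (auto simp: prefix_of_def composable_def)
  obtain \<beta> where b: "\<beta> \<preceq> \<phi>" "deg \<Lambda> \<beta> = m"
    using prefix_exists assms by metis
  then have "initial_seg \<Lambda> \<phi> m = \<beta>"
    unfolding initial_seg_def * using prefix_unique by blast
  then show ?thesis using b prefix_unique by blast
qed

text \<open>The equality of the two composites already makes \<alpha> and \<beta> prefixes, so of
  the conditions in \<open>MCE\<close> only the degree remains. The left side adds membership of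
  \<alpha> and \<beta> in \<Lambda>, which \<open>Lmin\<close> does not record.\<close>

lemma Lmin_iff:
  "(\<rho>, \<tau>) \<in> Lmin \<Lambda> \<alpha> \<beta> \<and> \<alpha> \<in> mor \<Lambda> \<and> \<beta> \<in> mor \<Lambda> \<longleftrightarrow>
    \<alpha> \<bowtie> \<rho> \<and> \<beta> \<bowtie> \<tau> \<and> \<alpha> \<cdot> \<rho> = \<beta> \<cdot> \<tau> \<and> deg \<Lambda> (\<alpha> \<cdot> \<rho>) = sup (deg \<Lambda> \<alpha>) (deg \<Lambda> \<beta>)"
    (is "?L \<longleftrightarrow> ?R")
proof
  assume L: ?L
  then have "\<alpha> \<bowtie> \<rho>" "\<beta> \<bowtie> \<tau>" "\<alpha> \<cdot> \<rho> = \<beta> \<cdot> \<tau>" "\<alpha> \<cdot> \<rho> \<in> MCE \<Lambda> \<alpha> \<beta>"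
    unfolding Lmin_def composable_def by blast+
  then show ?R unfolding MCE_def by simp
next
  assume R: ?R
  have "\<alpha> \<cdot> \<rho> \<in> MCE \<Lambda> \<alpha> \<beta>"
    unfolding MCE_def using R
    by (metis (mono_tags, lifting) mem_Collect_eq composableD(4) initial_seg_eq_iff prefixI sup_ge1 sup_ge2)
  then show ?L using R unfolding Lmin_def composable_def by simp
qed

text \<open>Every common extension passes through a minimal one: cut \<alpha>\<xi> at the maximum of
  the two degrees, and both \<alpha> and \<beta> are still prefixes of what is left.\<close>

lemma common_extension_Lmin:
  assumes "\<alpha> \<bowtie> \<xi>" "\<beta> \<preceq> \<alpha> \<cdot> \<xi>"
  obtains \<rho> \<tau> where "(\<rho>, \<tau>) \<in> Lmin \<Lambda> \<alpha> \<beta>" "\<rho> \<preceq> \<xi>" "\<alpha> \<bowtie> \<rho>" "\<beta> \<bowtie> \<tau>" "\<alpha> \<cdot> \<rho> = \<beta> \<cdot> \<tau>"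
    "deg \<Lambda> (\<alpha> \<cdot> \<rho>) = sup (deg \<Lambda> \<alpha>) (deg \<Lambda> \<beta>)"
proof -
  have a: "\<alpha> \<preceq> \<alpha> \<cdot> \<xi>" using assms prefixI by blast
  obtain \<eta> where c: "\<eta> \<preceq> \<alpha> \<cdot> \<xi>" "deg \<Lambda> \<eta> = sup (deg \<Lambda> \<alpha>) (deg \<Lambda> \<beta>)"
    using prefix_exists[of "\<alpha> \<cdot> \<xi>" "sup (deg \<Lambda> \<alpha>) (deg \<Lambda> \<beta>)"] prefixD(2,4)[OF a] prefixD(4)[OF assms(2)]
    by auto
  have "\<alpha> \<preceq> \<eta>" "\<beta> \<preceq> \<eta>"
    using prefix_linear[OF a c(1)] prefix_linear[OF assms(2) c(1)] c(2) by simp_all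
  then obtain \<rho> \<tau> where r: "\<alpha> \<bowtie> \<rho>" "\<eta> = \<alpha> \<cdot> \<rho>" "\<beta> \<bowtie> \<tau>" "\<eta> = \<beta> \<cdot> \<tau>"
    by (auto elim!: prefixE)
  moreover have "(\<rho>, \<tau>) \<in> Lmin \<Lambda> \<alpha> \<beta>"
    using Lmin_iff[of \<rho> \<tau> \<alpha> \<beta>] r c by auto
  moreover have "\<rho> \<preceq> \<xi>" using c(1) r assms(1) prefix_cmp_iff by auto
  ultimately show ?thesis using that c by auto
qed


section \<open>Paths and their initial segments\<close>

text \<open>A boundary path without the condition on finite exhaustive sets. Paths are first built
  as such functors, and the condition is checked afterwards.\<close>

definition kpath :: "('a, 'k) kpath \<Rightarrow> bool" where
  "kpath x \<longleftrightarrow> snd x \<in> extensional (mor (Omega (pdeg x))) \<and> kgraph_functor (Omega (pdeg x)) \<Lambda> (snd x)"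

text \<open>The initial segments of x. They form a directed set that determines x, and most later
  arguments see a path only through this predicate.\<close>

definition pre :: "('a, 'k) kpath \<Rightarrow> 'a \<Rightarrow> bool" where
  "pre x \<phi> \<longleftrightarrow> \<phi> \<in> mor \<Lambda> \<and> env (deg \<Lambda> \<phi>) \<le> pdeg x \<and> pval x 0 (deg \<Lambda> \<phi>) = \<phi>"

lemma kpath_iff:
  "kpath x \<longleftrightarrow> snd x \<in> extensional (mor (Omega (pdeg x))) \<and>
    (\<forall>p q. p \<le> q \<longrightarrow> env q \<le> pdeg x \<longrightarrow> pval x p q \<in> mor \<Lambda> \<and> rng \<Lambda> (pval x p q) = pval x p p \<and>
      src \<Lambda> (pval x p q) = pval x q q \<and> deg \<Lambda> (pval x p q) = q - p) \<and>
    (\<forall>p q t. p \<le> q \<longrightarrow> q \<le> t \<longrightarrow> env t \<le> pdeg x \<longrightarrow> pval x p t = pval x p q \<cdot> pval x q t)"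
  (is "_ \<longleftrightarrow> ?E \<and> ?A \<and> ?B")
proof -
  have "kgraph_functor (Omega (pdeg x)) \<Lambda> (snd x) \<longleftrightarrow> ?A \<and> ?B"
    (is "?F \<longleftrightarrow> _")
  proof
    assume F: ?F
    have ?A
    proof (intro allI impI)
      fix p q :: "'k \<Rightarrow> nat" assume "p \<le> q" "env q \<le> pdeg x"
      then have "(p, q) \<in> mor (Omega (pdeg x))" by (simp add: mor_Omega)
      then have "pval x p q \<in> mor \<Lambda>" "snd x (rng (Omega (pdeg x)) (p, q)) = rng \<Lambda> (pval x p q)"
        "snd x (src (Omega (pdeg x)) (p, q)) = src \<Lambda> (pval x p q)"
        "deg \<Lambda> (pval x p q) = deg (Omega (pdeg x)) (p, q)"
        using F unfolding kgraph_functor_def by blast+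
      then show "pval x p q \<in> mor \<Lambda> \<and> rng \<Lambda> (pval x p q) = pval x p p \<and>
          src \<Lambda> (pval x p q) = pval x q q \<and> deg \<Lambda> (pval x p q) = q - p"
        by (simp add: Omega_def)
    qed
    moreover have ?B
    proof (intro allI impI)
      fix p q t :: "'k \<Rightarrow> nat" assume *: "p \<le> q" "q \<le> t" "env t \<le> pdeg x"
      then have "(p, q) \<in> mor (Omega (pdeg x))" "(q, t) \<in> mor (Omega (pdeg x))"
        using env_le_trans by (auto simp: mor_Omega)
      moreover have "src (Omega (pdeg x)) (p, q) = rng (Omega (pdeg x)) (q, t)"
        by (simp add: Omega_def)
      ultimately have "snd x (cmp (Omega (pdeg x)) (p, q) (q, t)) = pval x p q \<cdot> pval x q t"
        using F unfolding kgraph_functor_def by blast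
      then show "pval x p t = pval x p q \<cdot> pval x q t"
        by (simp add: Omega_def)
    qed
    ultimately show "?A \<and> ?B" ..
  next
    assume "?A \<and> ?B"
    then show ?F
      unfolding kgraph_functor_def by (auto simp: Omega_def)
  qed
  then show ?thesis by (simp add: kpath_def)
qed

lemma kpathD:
  assumes "kpath x" "p \<le> q" "env q \<le> pdeg x"
  shows "pval x p q \<in> mor \<Lambda>" "rng \<Lambda> (pval x p q) = pval x p p"
    "src \<Lambda> (pval x p q) = pval x q q" "deg \<Lambda> (pval x p q) = q - p"
  using assms unfolding kpath_iff by blast+

lemma kpath_split:
  assumes "kpath x" "p \<le> q" "q \<le> t" "env t \<le> pdeg x"
  shows "pval x p t = pval x p q \<cdot> pval x q t" "pval x p q \<bowtie> pval x q t"
proof -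
  show "pval x p t = pval x p q \<cdot> pval x q t" using assms unfolding kpath_iff by blast
  have q: "env q \<le> pdeg x" using env_le_trans assms(3,4) .
  show "pval x p q \<bowtie> pval x q t"
    using kpathD[OF assms(1) assms(2) q] kpathD[OF assms(1,3,4)] by (simp add: composable_def)
qed

lemma pre_pval:
  assumes "kpath x" "env q \<le> pdeg x"
  shows "pre x (pval x 0 q)" "deg \<Lambda> (pval x 0 q) = q"
proof -
  show d: "deg \<Lambda> (pval x 0 q) = q"
    using kpathD(4)[OF assms(1) zero_le_fun assms(2)] by (simp add: fun_eq_iff)
  show "pre x (pval x 0 q)"
    using kpathD(1)[OF assms(1) zero_le_fun assms(2)] assms(2) d by (simp add: pre_def)
qed

lemma preD:
  assumes "pre x \<phi>"
  shows "\<phi> \<in> mor \<Lambda>" "env (deg \<Lambda> \<phi>) \<le> pdeg x" "pval x 0 (deg \<Lambda> \<phi>) = \<phi>"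
  using assms by (auto simp: pre_def)

lemma kpath_vertex:
  assumes "kpath x" "pre x \<phi>"
  shows "pval x (deg \<Lambda> \<phi>) (deg \<Lambda> \<phi>) = src \<Lambda> \<phi>" "prng x = rng \<Lambda> \<phi>"
  using kpathD[OF assms(1) zero_le_fun preD(2)[OF assms(2)]] preD[OF assms(2)] by auto

text \<open>The segment of x of degree d(\<alpha>) + d(\<nu>) factorises both as \<alpha>\<nu> and
  by splitting x at d(\<alpha>); unique factorisation identifies the factors.\<close>

lemma pval_cmp:
  assumes "kpath x" "\<alpha> \<bowtie> \<nu>" "pre x (\<alpha> \<cdot> \<nu>)"
  shows "pre x \<alpha>" "pval x (deg \<Lambda> \<alpha>) (deg \<Lambda> \<alpha> + deg \<Lambda> \<nu>) = \<nu>"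
proof -
  note d = composableD(7)[OF assms(2)]
  have le: "env (deg \<Lambda> \<alpha> + deg \<Lambda> \<nu>) \<le> pdeg x"
    using preD(2)[OF assms(3)] by (simp only: d)
  note s = kpath_split[where t = "deg \<Lambda> \<alpha> + deg \<Lambda> \<nu>", OF assms(1) zero_le_fun le_add_fun le]
  have e: "env (deg \<Lambda> \<alpha>) \<le> pdeg x"
    using env_le_trans[OF le_add_fun le] .
  have "\<alpha> \<cdot> \<nu> = pval x 0 (deg \<Lambda> \<alpha>) \<cdot> pval x (deg \<Lambda> \<alpha>) (deg \<Lambda> \<alpha> + deg \<Lambda> \<nu>)"
    using s(1) preD(3)[OF assms(3)] by (simp only: d)
  note f = factorisation_unique[OF assms(2) s(2) this pre_pval(2)[OF assms(1) e, symmetric]]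
  show "pre x \<alpha>" using f(1) e composableD(1)[OF assms(2)] by (simp add: pre_def)
  show "pval x (deg \<Lambda> \<alpha>) (deg \<Lambda> \<alpha> + deg \<Lambda> \<nu>) = \<nu>" using f(2) by simp
qed

lemma pre_prefix: "kpath x \<Longrightarrow> pre x \<phi> \<Longrightarrow> \<alpha> \<preceq> \<phi> \<Longrightarrow> pre x \<alpha>"
  by (metis prefixE pval_cmp(1))

lemma pval_0_prefix:
  assumes "kpath x" "p \<le> q" "env q \<le> pdeg x"
  shows "pval x 0 p \<preceq> pval x 0 q"
  using kpath_split[OF assms(1) zero_le_fun assms(2,3)] prefixI by simp

lemma pre_directed:
  assumes "kpath x" "pre x \<phi>" "pre x \<psi>"
  obtains \<eta> where "pre x \<eta>" "\<phi> \<preceq> \<eta>" "\<psi> \<preceq> \<eta>"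
proof -
  define n where "n = sup (deg \<Lambda> \<phi>) (deg \<Lambda> \<psi>)"
  have n: "env n \<le> pdeg x" unfolding n_def using env_sup_le preD(2) assms by metis
  have le: "deg \<Lambda> \<phi> \<le> n" "deg \<Lambda> \<psi> \<le> n" by (simp_all add: n_def)
  have "\<phi> \<preceq> pval x 0 n" "\<psi> \<preceq> pval x 0 n"
    using pval_0_prefix[where q = n, OF assms(1) _ n] le preD(3) assms(2,3) by metis+
  then show ?thesis using that pre_pval(1)[OF assms(1) n] by blast
qed

lemma pre_unique: "pre x \<phi> \<Longrightarrow> pre x \<psi> \<Longrightarrow> deg \<Lambda> \<phi> = deg \<Lambda> \<psi> \<Longrightarrow> \<phi> = \<psi>"
  by (metis preD(3))

lemma pre_prng: "kpath x \<Longrightarrow> pre x (prng x)"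
  using pre_pval(1)[of x 0] by (simp add: le_fun_def enat_0)

lemma prng_vertex: "kpath x \<Longrightarrow> prng x \<in> verts \<Lambda>"
  using pre_prng kpath_vertex(2) preD(1) rng_in_verts by metis

text \<open>If the degree of x exceeded that of y in one direction, the latter would be finite
  there, and x would have an initial segment too long for y.\<close>

lemma pdeg_le_if_pre_le:
  assumes "kpath x" "\<And>\<phi>. pre x \<phi> \<Longrightarrow> pre y \<phi>"
  shows "pdeg x \<le> pdeg y"
proof (rule le_funI, rule ccontr)
  fix i assume "\<not> pdeg x i \<le> pdeg y i"
  then obtain n where n: "pdeg y i = enat n" "enat (Suc n) \<le> pdeg x i"
    by (cases "pdeg y i") (auto simp: not_le Suc_ile_eq)
  \<comment> \<open>A multiple of the i-th unit vector, one step beyond the end of y.\<close>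
  define q where "q = (\<lambda>j. if j = i then Suc n else 0)"
  have "env q \<le> pdeg x"
    using n(2) by (auto simp: q_def le_fun_def zero_enat_def[symmetric])
  then have "pre y (pval x 0 q)" "deg \<Lambda> (pval x 0 q) = q"
    using pre_pval assms by auto
  then have "env q \<le> pdeg y" using preD(2) by metis
  then have "enat (q i) \<le> pdeg y i" by (rule le_funD)
  then show False using n(1) by (simp add: q_def)
qed

text \<open>The initial segments determine the degree and all x(0,q); then x(p,q) is recovered from
  x(0,q) = x(0,p) x(p,q) by left cancellation. Outside the morphisms of \<Omega> extensionality
  settles equality.\<close>

lemma kpath_eqI:
  assumes x: "kpath x" and y: "kpath y" and "\<And>\<phi>. pre x \<phi> \<longleftrightarrow> pre y \<phi>"
  shows "x = y"
proof -
  have d: "pdeg x = pdeg y"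
    using pdeg_le_if_pre_le assms by (metis order_antisym)
  have 0: "pval x 0 q = pval y 0 q" if "env q \<le> pdeg x" for q
    using pre_pval[OF x that] assms(3) preD(3) by metis
  have "snd x = snd y"
  proof (rule extensionalityI)
    show "snd x \<in> extensional (mor (Omega (pdeg x)))" using x by (simp add: kpath_def)
    show "snd y \<in> extensional (mor (Omega (pdeg x)))" using y d by (simp add: kpath_def)
    fix a assume "a \<in> mor (Omega (pdeg x))"
    then obtain p q where a: "a = (p, q)" "p \<le> q" "env q \<le> pdeg x"
      by (cases a) (auto simp: mor_Omega)
    show "snd x a = snd y a"
      using kpath_split[OF x zero_le_fun a(2,3)] kpath_split[OF y zero_le_fun a(2)] a(3) d
        0[OF a(3)] 0[OF env_le_trans[OF a(2,3)]] cmp_left_cancel unfolding a(1) by metis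
  qed
  then show ?thesis using d by (simp add: prod_eq_iff)
qed

text \<open>Each q i is finite, so a single member of F reaches it in direction i; directedness
  merges the members found for the finitely many directions.\<close>

lemma directed_set_dominates:
  assumes "F \<noteq> {}" "\<And>\<phi> \<psi>. \<phi> \<in> F \<Longrightarrow> \<psi> \<in> F \<Longrightarrow> \<exists>\<eta>\<in>F. \<phi> \<preceq> \<eta> \<and> \<psi> \<preceq> \<eta>"
    "env q \<le> (\<lambda>i. SUP \<phi>\<in>F. enat (deg \<Lambda> \<phi> i))"
  shows "\<exists>\<phi>\<in>F. q \<le> deg \<Lambda> \<phi>"
proof -
  have 1: "\<exists>\<phi>\<in>F. q i \<le> deg \<Lambda> \<phi> i" for i
  proof (cases "q i")
    case 0 then show ?thesis using assms(1) by auto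
  next
    \<comment> \<open>The supremum need not be attained. The bound by n + 1 is read as a strict
      bound by n, which some member of F already exceeds.\<close>
    case (Suc n)
    have "enat (q i) \<le> (SUP \<phi>\<in>F. enat (deg \<Lambda> \<phi> i))" using le_funD[OF assms(3)] .
    then have "enat n < (SUP \<phi>\<in>F. enat (deg \<Lambda> \<phi> i))"
      using Suc by (simp add: Suc_ile_eq)
    then obtain \<phi> where "\<phi> \<in> F" "enat n < enat (deg \<Lambda> \<phi> i)" by (auto simp: less_SUP_iff)
    then show ?thesis using Suc by (auto intro!: bexI[of _ \<phi>])
  qed
  have "\<exists>\<phi>\<in>F. \<forall>i\<in>I. q i \<le> deg \<Lambda> \<phi> i" if "finite I" for I
    using that
  proof induction
    case empty then show ?case using assms(1) by auto
  next
    case (insert i I)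
    then obtain \<phi> \<psi> where *: "\<phi> \<in> F" "\<forall>j\<in>I. q j \<le> deg \<Lambda> \<phi> j" "\<psi> \<in> F" "q i \<le> deg \<Lambda> \<psi> i"
      using 1 by meson
    obtain \<eta> where e: "\<eta> \<in> F" "\<phi> \<preceq> \<eta>" "\<psi> \<preceq> \<eta>" using assms(2) *(1,3) by blast
    then have "deg \<Lambda> \<phi> j \<le> deg \<Lambda> \<eta> j" "deg \<Lambda> \<psi> j \<le> deg \<Lambda> \<eta> j" for j
      using prefixD(4) by (auto simp: le_fun_def)
    then have "\<forall>j\<in>insert i I. q j \<le> deg \<Lambda> \<eta> j" using *(2,4) by (auto intro: order_trans)
    then show ?case using e(1) by blast
  qed
  from this[of UNIV] show ?thesis by (simp add: le_fun_def)
qed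

text \<open>The degree of the path is the coordinatewise supremum of the degrees in F. Each q below
  it is the degree of exactly one member of F, which becomes x(0,q), and the other values are
  complementary factors.\<close>

lemma directed_set_path:
  assumes "F \<subseteq> mor \<Lambda>" "F \<noteq> {}"
    and hereditary: "\<And>\<phi> \<alpha>. \<phi> \<in> F \<Longrightarrow> \<alpha> \<preceq> \<phi> \<Longrightarrow> \<alpha> \<in> F"
    and directed: "\<And>\<phi> \<psi>. \<phi> \<in> F \<Longrightarrow> \<psi> \<in> F \<Longrightarrow> \<exists>\<eta>\<in>F. \<phi> \<preceq> \<eta> \<and> \<psi> \<preceq> \<eta>"
  shows "\<exists>x. kpath x \<and> (\<forall>\<phi>. pre x \<phi> \<longleftrightarrow> \<phi> \<in> F)"
proof -
  define m where "m = (\<lambda>i. SUP \<phi>\<in>F. enat (deg \<Lambda> \<phi> i))"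
  have "\<exists>\<phi>\<in>F. deg \<Lambda> \<phi> = q" if q: "env q \<le> m" for q
  proof -
    obtain \<phi> where "\<phi> \<in> F" "q \<le> deg \<Lambda> \<phi>"
      using directed_set_dominates[OF assms(2) directed q[unfolded m_def]] by blast
    then show ?thesis using prefix_exists assms(1) hereditary by (metis subsetD)
  qed
  \<comment> \<open>P q is the future x(0,q).\<close>
  then obtain P where P: "P q \<in> F" "deg \<Lambda> (P q) = q" if "env q \<le> m" for q
    by metis
  have deg_le: "env (deg \<Lambda> \<phi>) \<le> m" if "\<phi> \<in> F" for \<phi>
    using that by (auto simp: m_def le_fun_def intro: SUP_upper)
  have P_eq: "P (deg \<Lambda> \<phi>) = \<phi>" if "\<phi> \<in> F" for \<phi>
    using directed[OF that P(1)[OF deg_le[OF that]]] prefix_unique P(2)[OF deg_le[OF that]] by metis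
  have "\<exists>\<nu>. P p \<bowtie> \<nu> \<and> P q = P p \<cdot> \<nu>" if pq: "p \<le> q" "env q \<le> m" for p q
  proof -
    note p = env_le_trans[OF pq]
    obtain \<eta> where "P p \<preceq> \<eta>" "P q \<preceq> \<eta>"
      using directed P(1)[OF p] P(1)[OF pq(2)] by blast
    then have "P p \<preceq> P q" using prefix_linear P(2)[OF p] P(2)[OF pq(2)] pq(1) by metis
    then show ?thesis by (auto elim: prefixE)
  qed
  \<comment> \<open>R p q is the future x(p,q), the factor that completes P p to P q.\<close>
  then obtain R where R: "P p \<bowtie> R p q" "P q = P p \<cdot> R p q" if "p \<le> q" "env q \<le> m" for p q
    by metis
  have R_refl: "R p p = src \<Lambda> (P p)" if "env p \<le> m" for p
  proof -
    have "P p \<in> mor \<Lambda>" using P(1)[OF that] assms(1) by auto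
    then show ?thesis
      using R[OF order_refl that] cmp_left_cancel composable_src id_right by metis
  qed
  have R_trans: "R p t = R p q \<cdot> R q t" if "p \<le> q" "q \<le> t" "env t \<le> m" for p q t
  proof -
    note q = env_le_trans[OF that(2,3)]
    note 1 = R[OF that(1) q] and 2 = R[OF that(2,3)] and 3 = R[OF order_trans[OF that(1,2)] that(3)]
    have 4: "R p q \<bowtie> R q t" using 1 2(1) composable_cmp_left by metis
    \<comment> \<open>Both sides complete P p to P t, so left cancellation yields
      functoriality.\<close>
    have "P p \<cdot> R p t = P p \<cdot> (R p q \<cdot> R q t)"
      using 1 2(2) 3(2) composable_assoc(3)[OF 1(1) 4] by metis
    then show ?thesis
      using cmp_left_cancel[OF 3(1) composable_assoc(2)[OF 1(1) 4]] by simp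
  qed
  define x :: "('a, 'k) kpath" where "x = (m, restrict (\<lambda>(p, q). R p q) (mor (Omega m)))"
  have x: "pdeg x = m" "\<And>p q. p \<le> q \<Longrightarrow> env q \<le> m \<Longrightarrow> pval x p q = R p q"
    by (auto simp: x_def mor_Omega)
  have k: "kpath x"
    unfolding kpath_iff
  proof (intro conjI allI impI)
    show "snd x \<in> extensional (mor (Omega (pdeg x)))" by (simp add: x_def)
    fix p q :: "'k \<Rightarrow> nat" assume pq: "p \<le> q" "env q \<le> pdeg x"
    then have q: "env q \<le> m" by (simp add: x(1))
    note p = env_le_trans[OF pq(1) q]
    note v = x(2)[OF pq(1) q] and vp = x(2)[OF order_refl p] and vq = x(2)[OF order_refl q]
    note r = R[OF pq(1) q]
    show "pval x p q \<in> mor \<Lambda>" using composableD(2)[OF r(1)] v by simp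
    show "rng \<Lambda> (pval x p q) = pval x p p"
      using composableD(3)[OF r(1)] v vp R_refl[OF p] by simp
    show "src \<Lambda> (pval x p q) = pval x q q"
      using composableD(6)[OF r(1)] r(2) v vq R_refl[OF q] by simp
    have "q = p + deg \<Lambda> (R p q)"
      using composableD(7)[OF r(1)] r(2) P(2)[OF p] P(2)[OF q] by metis
    then show "deg \<Lambda> (pval x p q) = q - p"
      unfolding v by (metis add_left_cancel_fun le_imp_add_diff pq(1))
  next
    fix p q t :: "'k \<Rightarrow> nat" assume t: "p \<le> q" "q \<le> t" "env t \<le> pdeg x"
    then have "env t \<le> m" by (simp add: x(1))
    then show "pval x p t = pval x p q \<cdot> pval x q t"
      using R_trans x(2) t env_le_trans order_trans by metis
  qed
  have R_0: "R 0 q = P q" if "env q \<le> m" for q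
  proof -
    have "env 0 \<le> m" using env_le_trans zero_le_fun that .
    then have "P 0 \<in> verts \<Lambda>" using P assms(1) by (auto simp: verts_def)
    then show ?thesis
      using R[OF zero_le_fun that] vertsD id_left composableD(2,3) by metis
  qed
  have "pre x \<phi> \<longleftrightarrow> \<phi> \<in> F" for \<phi>
  proof
    assume a: "pre x \<phi>"
    then have d: "env (deg \<Lambda> \<phi>) \<le> m" using preD(2) x(1) by metis
    have "\<phi> = P (deg \<Lambda> \<phi>)"
      using preD(3)[OF a] x(2)[OF zero_le_fun d] R_0[OF d] by simp
    then show "\<phi> \<in> F" using P(1)[OF d] by simp
  next
    assume "\<phi> \<in> F"
    then show "pre x \<phi>"
      using deg_le x R_0 P_eq zero_le_fun assms(1) unfolding pre_def by (metis subsetD)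
  qed
  then show ?thesis using k by blast
qed


section \<open>Boundary paths\<close>

text \<open>An index n corresponds to the initial segment \<phi> = x(0,n), whose source is x(n).
  Then x(n, n + d(\<beta>)) = \<beta> says exactly that \<phi>\<beta> is again an initial
  segment.\<close>

lemma boundary_iff:
  "x \<in> boundary_paths \<Lambda> \<longleftrightarrow> kpath x \<and>
    (\<forall>\<phi>. pre x \<phi> \<longrightarrow> (\<forall>E\<in>FE \<Lambda> (src \<Lambda> \<phi>). \<exists>\<beta>\<in>E. pre x (\<phi> \<cdot> \<beta>)))"
proof -
  have *: "(\<forall>n. env n \<le> pdeg x \<longrightarrow> (\<forall>E \<in> FE \<Lambda> (pval x n n).
        \<exists>\<alpha>\<in>E. env (n + deg \<Lambda> \<alpha>) \<le> pdeg x \<and> pval x n (n + deg \<Lambda> \<alpha>) = \<alpha>)) \<longleftrightarrow>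
      (\<forall>\<phi>. pre x \<phi> \<longrightarrow> (\<forall>E\<in>FE \<Lambda> (src \<Lambda> \<phi>). \<exists>\<beta>\<in>E. pre x (\<phi> \<cdot> \<beta>)))" (is "?L \<longleftrightarrow> ?R")
    if x: "kpath x"
  proof
    assume L: ?L
    show ?R
    proof (intro allI impI ballI)
      fix \<phi> E assume p: "pre x \<phi>" and E: "E \<in> FE \<Lambda> (src \<Lambda> \<phi>)"
      then obtain \<beta> where b: "\<beta> \<in> E" "env (deg \<Lambda> \<phi> + deg \<Lambda> \<beta>) \<le> pdeg x"
          "pval x (deg \<Lambda> \<phi>) (deg \<Lambda> \<phi> + deg \<Lambda> \<beta>) = \<beta>"
        using L preD(2) kpath_vertex(1)[OF x] by metis
      have "pval x 0 (deg \<Lambda> \<phi> + deg \<Lambda> \<beta>) = \<phi> \<cdot> \<beta>"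
        using kpath_split(1)[where t = "deg \<Lambda> \<phi> + deg \<Lambda> \<beta>", OF x zero_le_fun le_add_fun b(2)]
          b(3) preD(3)[OF p] by simp
      then show "\<exists>\<beta>\<in>E. pre x (\<phi> \<cdot> \<beta>)" using pre_pval(1)[OF x b(2)] b(1) by metis
    qed
  next
    assume R: ?R
    show ?L
    proof (intro allI impI ballI)
      fix n E assume n: "env n \<le> pdeg x" and E: "E \<in> FE \<Lambda> (pval x n n)"
      note p = pre_pval[OF x n]
      have s: "src \<Lambda> (pval x 0 n) = pval x n n" using kpath_vertex(1)[OF x p(1)] p(2) by simp
      then obtain \<beta> where b: "\<beta> \<in> E" "pre x (pval x 0 n \<cdot> \<beta>)" using R p(1) E by metis
      have "pval x 0 n \<bowtie> \<beta>"
        using E b(1) s preD(1)[OF p(1)] by (auto simp: FE_def out_of_def composable_def)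
      then show "\<exists>\<alpha>\<in>E. env (n + deg \<Lambda> \<alpha>) \<le> pdeg x \<and> pval x n (n + deg \<Lambda> \<alpha>) = \<alpha>"
        using b pval_cmp(2)[OF x] p(2) preD(2)[OF b(2)] composableD(7) by metis
    qed
  qed
  show ?thesis using * by (auto simp: boundary_paths_def kpath_def)
qed

section \<open>Removing an initial segment\<close>

text \<open>The shift is indexed by an initial segment \<phi> instead of its degree n; this covers
  every n \<le> d(x), with \<phi> = x(0,n). The second claim comes from splitting x(0, n + d(\<xi>))
  at n.\<close>

lemma
  assumes x: "kpath x" and p: "pre x \<phi>"
  shows kpath_shift: "kpath (shift (deg \<Lambda> \<phi>) x)"
    and pre_shift_iff: "pre (shift (deg \<Lambda> \<phi>) x) \<xi> \<longleftrightarrow> \<phi> \<bowtie> \<xi> \<and> pre x (\<phi> \<cdot> \<xi>)"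
proof -
  define n where "n = deg \<Lambda> \<phi>"
  define y where "y = shift n x"
  have n: "env n \<le> pdeg x" using preD(2)[OF p] by (simp add: n_def)
  have d: "env q \<le> pdeg y \<longleftrightarrow> env (n + q) \<le> pdeg x" for q
  proof -
    have "pdeg y = pdeg x - env n" by (simp add: y_def shift_def Let_def)
    then show ?thesis using env_le_minus_iff[OF n, of q] by (simp only:)
  qed
  have v: "pval y a b = pval x (n + a) (n + b)" if "a \<le> b" "env b \<le> pdeg y" for a b
    using that by (simp add: y_def shift_def Let_def mor_Omega)
  have k: "kpath y"
    unfolding kpath_iff
  proof (intro conjI allI impI)
    show "snd y \<in> extensional (mor (Omega (pdeg y)))" by (simp add: y_def shift_def Let_def)
    fix a b :: "'k \<Rightarrow> nat" assume ab: "a \<le> b" "env b \<le> pdeg y"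
    note D = kpathD[where q = "n + b", OF x add_left_mono_fun[THEN iffD2, OF ab(1)] ab(2)[unfolded d]]
    note v = v[OF ab] v[OF order_refl ab(2)] v[OF order_refl env_le_trans[OF ab]]
    show "pval y a b \<in> mor \<Lambda>" "rng \<Lambda> (pval y a b) = pval y a a"
      "src \<Lambda> (pval y a b) = pval y b b" "deg \<Lambda> (pval y a b) = b - a"
      using D unfolding v by (simp_all add: fun_eq_iff)
  next
    fix a b t :: "'k \<Rightarrow> nat" assume t: "a \<le> b" "b \<le> t" "env t \<le> pdeg y"
    note v = v[OF order_trans[OF t(1,2)] t(3)] v[OF t(1) env_le_trans[OF t(2,3)]] v[OF t(2,3)]
    show "pval y a t = pval y a b \<cdot> pval y b t"
      unfolding v using kpath_split(1)[where t = "n + t", OF x _ _ t(3)[unfolded d]] t(1,2)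
      by (simp only: add_left_mono_fun)
  qed
  then show "kpath (shift (deg \<Lambda> \<phi>) x)" by (simp add: y_def n_def)
  have "pre y \<xi> \<longleftrightarrow> \<phi> \<bowtie> \<xi> \<and> pre x (\<phi> \<cdot> \<xi>)"
  proof
    assume a: "pre y \<xi>"
    note e = preD(2)[OF a, unfolded d]
    have xi: "pval x n (n + deg \<Lambda> \<xi>) = \<xi>"
      using v[OF zero_le_fun preD(2)[OF a]] preD(3)[OF a] by (simp only: add_0_right)
    note s = kpath_split[where t = "n + deg \<Lambda> \<xi>", OF x zero_le_fun le_add_fun e]
    have "pval x 0 n = \<phi>" using preD(3)[OF p] by (simp add: n_def)
    then show "\<phi> \<bowtie> \<xi> \<and> pre x (\<phi> \<cdot> \<xi>)"
      using s pre_pval(1)[where q = "n + deg \<Lambda> \<xi>", OF x e] xi by (simp only:)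
  next
    assume a: "\<phi> \<bowtie> \<xi> \<and> pre x (\<phi> \<cdot> \<xi>)"
    have e: "env (n + deg \<Lambda> \<xi>) \<le> pdeg x"
      using a preD(2) composableD(7) n_def by metis
    have "pval y 0 (deg \<Lambda> \<xi>) = \<xi>"
      using v[OF zero_le_fun] e d pval_cmp(2)[OF x] a n_def by (metis add_0_right)
    then show "pre y \<xi>" using e d composableD(2) a unfolding pre_def by blast
  qed
  then show "pre (shift (deg \<Lambda> \<phi>) x) \<xi> \<longleftrightarrow> \<phi> \<bowtie> \<xi> \<and> pre x (\<phi> \<cdot> \<xi>)"
    by (simp add: y_def n_def)
qed

lemma boundaryD:
  assumes "x \<in> boundary_paths \<Lambda>"
  shows "kpath x" "pre x \<phi> \<Longrightarrow> E \<in> FE \<Lambda> (src \<Lambda> \<phi>) \<Longrightarrow> \<exists>\<beta>\<in>E. pre x (\<phi> \<cdot> \<beta>)"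
  using assms unfolding boundary_iff by blast+

text \<open>A segment \<xi> of the shifted path and the segment \<phi>\<xi> of x have the same
  source, so the condition for x at \<phi>\<xi> gives the one for the shift at \<xi>.\<close>

lemma shift_boundary:
  assumes "x \<in> boundary_paths \<Lambda>" "pre x \<phi>"
  shows "shift (deg \<Lambda> \<phi>) x \<in> boundary_paths \<Lambda>"
  unfolding boundary_iff
proof (intro conjI allI impI ballI)
  note k = boundaryD(1)[OF assms(1)]
  show "kpath (shift (deg \<Lambda> \<phi>) x)" using kpath_shift k assms(2) .
  fix \<xi> E assume "pre (shift (deg \<Lambda> \<phi>) x) \<xi>" and E: "E \<in> FE \<Lambda> (src \<Lambda> \<xi>)"
  then have 1: "\<phi> \<bowtie> \<xi>" "pre x (\<phi> \<cdot> \<xi>)" using pre_shift_iff[OF k assms(2)] by auto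
  then obtain \<beta> where b: "\<beta> \<in> E" "pre x (\<phi> \<cdot> \<xi> \<cdot> \<beta>)"
    using boundaryD(2)[OF assms(1)] E composableD(6) by metis
  have "\<xi> \<bowtie> \<beta>" using E b(1) 1(1) by (auto simp: FE_def out_of_def composable_def)
  then show "\<exists>\<beta>\<in>E. pre (shift (deg \<Lambda> \<phi>) x) (\<xi> \<cdot> \<beta>)"
    using b 1(1) composable_assoc[of \<phi> \<xi> \<beta>] pre_shift_iff[OF k assms(2)] by auto
qed

section \<open>Prepending a morphism\<close>

text \<open>Transport of a finite exhaustive set along \<nu>. Finite alignment keeps the new set
  finite. For exhaustiveness, apply that of E to \<nu>\<zeta> and cut the resulting common extension
  down to a minimal one of \<nu> and a member of E.\<close>

lemma FE_extend:
  assumes "finitely_aligned \<Lambda>" "\<nu> \<in> mor \<Lambda>" "E \<in> FE \<Lambda> (rng \<Lambda> \<nu>)" "\<And>\<beta>. \<beta> \<in> E \<Longrightarrow> \<not> \<beta> \<preceq> \<nu>"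
  shows "(\<Union>\<beta>\<in>E. fst ` Lmin \<Lambda> \<nu> \<beta>) \<in> FE \<Lambda> (src \<Lambda> \<nu>)" (is "?E' \<in> _")
proof -
  have E: "finite E" "\<And>\<beta>. \<beta> \<in> E \<Longrightarrow> \<beta> \<in> mor \<Lambda>" "exhaustive \<Lambda> (rng \<Lambda> \<nu>) E"
    using assms(3) by (auto simp: FE_def out_of_def)
  have "finite ?E'"
    using E(1,2) assms(1,2) by (auto simp: finitely_aligned_def)
  moreover have "?E' \<subseteq> out_of \<Lambda> (src \<Lambda> \<nu>) - {src \<Lambda> \<nu>}"
  proof
    fix \<rho> assume "\<rho> \<in> ?E'"
    then obtain \<beta> \<tau> where b: "\<beta> \<in> E" "(\<rho>, \<tau>) \<in> Lmin \<Lambda> \<nu> \<beta>" by auto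
    then have r: "\<nu> \<bowtie> \<rho>" "\<beta> \<bowtie> \<tau>" "\<nu> \<cdot> \<rho> = \<beta> \<cdot> \<tau>"
      using Lmin_iff[of \<rho> \<tau> \<nu> \<beta>] assms(2) E(2) by auto
    \<comment> \<open>Otherwise \<nu> = \<beta>\<tau>, which would make \<beta> a prefix of
      \<nu>.\<close>
    have "\<rho> \<noteq> src \<Lambda> \<nu>"
      using r assms(4)[OF b(1)] id_right[OF assms(2)] prefixI by metis
    then show "\<rho> \<in> out_of \<Lambda> (src \<Lambda> \<nu>) - {src \<Lambda> \<nu>}"
      using r(1) by (auto simp: out_of_def composable_def)
  qed
  moreover have "\<exists>\<rho>\<in>?E'. Lmin \<Lambda> \<zeta> \<rho> \<noteq> {}" if z: "\<zeta> \<in> out_of \<Lambda> (src \<Lambda> \<nu>)" for \<zeta>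
  proof -
    have nz: "\<nu> \<bowtie> \<zeta>" using z assms(2) by (auto simp: out_of_def composable_def)
    then have "\<nu> \<cdot> \<zeta> \<in> out_of \<Lambda> (rng \<Lambda> \<nu>)" by (simp add: out_of_def composableD)
    then obtain \<beta> \<rho> \<tau> where b: "\<beta> \<in> E" "(\<rho>, \<tau>) \<in> Lmin \<Lambda> (\<nu> \<cdot> \<zeta>) \<beta>"
      using E(3) by (fastforce simp: exhaustive_def)
    then have r: "\<nu> \<cdot> \<zeta> \<bowtie> \<rho>" "\<beta> \<bowtie> \<tau>" "\<nu> \<cdot> \<zeta> \<cdot> \<rho> = \<beta> \<cdot> \<tau>"
      using Lmin_iff[of \<rho> \<tau> "\<nu> \<cdot> \<zeta>" \<beta>] E(2) composableD(4)[OF nz] by auto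
    have zr: "\<zeta> \<bowtie> \<rho>" using r(1) nz composable_cmp_left by simp
    note as = composable_assoc[OF nz zr]
    have "\<beta> \<preceq> \<nu> \<cdot> (\<zeta> \<cdot> \<rho>)" using r as prefixI by metis
    \<comment> \<open>Here \<rho>' belongs to the transported set and \<zeta>\<rho> is a common
      extension of \<zeta> and \<rho>'.\<close>
    then obtain \<rho>' \<tau>' where "(\<rho>', \<tau>') \<in> Lmin \<Lambda> \<nu> \<beta>" "\<rho>' \<preceq> \<zeta> \<cdot> \<rho>"
      using common_extension_Lmin[OF as(2)] by metis
    then show ?thesis
      using b(1) common_extension_Lmin[OF zr] by (metis UN_I empty_iff fst_conv image_eqI)
  qed
  ultimately show ?thesis
    using src_in_verts[OF assms(2)] unfolding FE_def exhaustive_def by blast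
qed

text \<open>Extend \<phi> to an initial segment \<phi>\<nu> = \<alpha>\<xi>. Either some member of E
  is a prefix of \<nu> and has already been passed, or E is transported along \<nu> to the source of
  \<xi>, where the condition for the shifted path applies.\<close>

lemma boundary_if_shift_boundary:
  assumes fa: "finitely_aligned \<Lambda>" and y: "kpath y" "pre y \<alpha>"
    and s: "shift (deg \<Lambda> \<alpha>) y \<in> boundary_paths \<Lambda>"
  shows "y \<in> boundary_paths \<Lambda>"
  unfolding boundary_iff
proof (intro conjI allI impI ballI)
  show "kpath y" by fact
  fix \<phi> E assume p: "pre y \<phi>" and E: "E \<in> FE \<Lambda> (src \<Lambda> \<phi>)"
  obtain \<eta> where e: "pre y \<eta>" "\<phi> \<preceq> \<eta>" "\<alpha> \<preceq> \<eta>" using pre_directed y p by metis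
  obtain \<nu> where n: "\<phi> \<bowtie> \<nu>" "\<eta> = \<phi> \<cdot> \<nu>" using e(2) by (rule prefixE)
  obtain \<xi> where x: "\<alpha> \<bowtie> \<xi>" "\<eta> = \<alpha> \<cdot> \<xi>" using e(3) by (rule prefixE)
  have c: "\<phi> \<bowtie> \<beta>" if "\<beta> \<in> E" for \<beta>
    using that E n(1) by (auto simp: FE_def out_of_def composable_def)
  have px: "pre (shift (deg \<Lambda> \<alpha>) y) \<xi>" using pre_shift_iff[OF y] x e(1) by simp
  show "\<exists>\<beta>\<in>E. pre y (\<phi> \<cdot> \<beta>)"
  proof (cases "\<exists>\<beta>\<in>E. \<beta> \<preceq> \<nu>")
    case True
    then obtain \<beta> where "\<beta> \<in> E" "\<beta> \<preceq> \<nu>" by auto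
    then show ?thesis
      using pre_prefix[OF y(1) e(1)] n prefix_cmp_iff c by metis
  next
    case False
    let ?E' = "\<Union>\<beta>\<in>E. fst ` Lmin \<Lambda> \<nu> \<beta>"
    have "?E' \<in> FE \<Lambda> (src \<Lambda> \<nu>)"
      using FE_extend[OF fa] False E n(1) by (simp add: composable_def)
    moreover have "src \<Lambda> \<nu> = src \<Lambda> \<xi>" using n x composableD(6) by metis
    ultimately obtain \<rho> where r: "\<rho> \<in> ?E'" "pre (shift (deg \<Lambda> \<alpha>) y) (\<xi> \<cdot> \<rho>)"
      using boundaryD(2)[OF s px] by metis
    then obtain \<beta> \<tau> where b: "\<beta> \<in> E" "(\<rho>, \<tau>) \<in> Lmin \<Lambda> \<nu> \<beta>" by auto
    then have m: "\<nu> \<bowtie> \<rho>" "\<beta> \<bowtie> \<tau>" "\<nu> \<cdot> \<rho> = \<beta> \<cdot> \<tau>"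
      using Lmin_iff[of \<rho> \<tau> \<nu> \<beta>] n(1) c[OF b(1)] composableD(2) by auto
    have xr: "\<xi> \<bowtie> \<rho>" using m(1) \<open>src \<Lambda> \<nu> = src \<Lambda> \<xi>\<close> x(1) by (simp add: composable_def)
    have "pre y (\<alpha> \<cdot> (\<xi> \<cdot> \<rho>))" using r(2) pre_shift_iff[OF y] by simp
    also have "\<alpha> \<cdot> (\<xi> \<cdot> \<rho>) = \<phi> \<cdot> (\<nu> \<cdot> \<rho>)"
      using composable_assoc(3)[OF x(1) xr] composable_assoc(3)[OF n(1) m(1)] n(2) x(2) by simp
    also have "\<dots> = \<phi> \<cdot> \<beta> \<cdot> \<tau>"
      using composable_assoc(3)[OF c[OF b(1)] m(2)] m(3) by simp
    finally have "pre y (\<phi> \<cdot> \<beta>)"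
      using pval_cmp(1)[OF y(1) composable_assoc(1)[OF c[OF b(1)] m(2)]] by simp
    then show ?thesis using b(1) by blast
  qed
qed

text \<open>By directedness every initial segment of y lies below one that extends \<alpha>. Hence
  \<alpha> and the shifted path determine y.\<close>

lemma pre_iff_of_shift:
  assumes y: "kpath y" "pre y \<alpha>"
  shows "pre y \<phi> \<longleftrightarrow> (\<exists>\<xi>. pre (shift (deg \<Lambda> \<alpha>) y) \<xi> \<and> \<phi> \<preceq> \<alpha> \<cdot> \<xi>)"
proof
  assume "pre y \<phi>"
  then obtain \<eta> where e: "pre y \<eta>" "\<phi> \<preceq> \<eta>" "\<alpha> \<preceq> \<eta>" using pre_directed y by metis
  then obtain \<xi> where "\<alpha> \<bowtie> \<xi>" "\<eta> = \<alpha> \<cdot> \<xi>" by (auto elim: prefixE)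
  then show "\<exists>\<xi>. pre (shift (deg \<Lambda> \<alpha>) y) \<xi> \<and> \<phi> \<preceq> \<alpha> \<cdot> \<xi>"
    using e pre_shift_iff[OF y] by auto
next
  assume "\<exists>\<xi>. pre (shift (deg \<Lambda> \<alpha>) y) \<xi> \<and> \<phi> \<preceq> \<alpha> \<cdot> \<xi>"
  then show "pre y \<phi>" using pre_shift_iff[OF y] pre_prefix[OF y(1)] by blast
qed

lemma boundary_paths_atD:
  assumes "z \<in> boundary_paths_at \<Lambda> v"
  shows "z \<in> boundary_paths \<Lambda>" "kpath z" "prng z = v" "v \<in> verts \<Lambda>" "pre z \<phi> \<Longrightarrow> rng \<Lambda> \<phi> = v"
proof -
  show z: "z \<in> boundary_paths \<Lambda>" and r: "prng z = v"
    using assms by (auto simp: boundary_paths_at_def)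
  show k: "kpath z" using boundaryD(1) z .
  show "v \<in> verts \<Lambda>" using prng_vertex k r by metis
  show "pre z \<phi> \<Longrightarrow> rng \<Lambda> \<phi> = v" using kpath_vertex(2)[OF k] r by metis
qed

text \<open>The prefixes of the morphisms \<alpha>\<xi>, with \<xi> an initial segment of z, form a
  directed set closed under prefixes, and so are the initial segments of a path.\<close>

lemma ex_extension:
  assumes \<alpha>: "\<alpha> \<in> mor \<Lambda>" and z: "z \<in> boundary_paths_at \<Lambda> (src \<Lambda> \<alpha>)"
  shows "\<exists>y. kpath y \<and> pre y \<alpha> \<and> shift (deg \<Lambda> \<alpha>) y = z"
proof -
  note k = boundary_paths_atD(2)[OF z]
  define F where "F = {\<phi>. \<exists>\<xi>. pre z \<xi> \<and> \<phi> \<preceq> \<alpha> \<cdot> \<xi>}"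
  have c: "\<alpha> \<bowtie> \<xi>" if "pre z \<xi>" for \<xi>
    using that \<alpha> boundary_paths_atD(5)[OF z] preD(1) by (simp add: composable_def)
  have F: "\<alpha> \<cdot> \<xi> \<in> F" if "pre z \<xi>" for \<xi>
    using that c prefix_refl composableD(4) by (auto simp: F_def)
  have "\<exists>y. kpath y \<and> (\<forall>\<phi>. pre y \<phi> \<longleftrightarrow> \<phi> \<in> F)"
  proof (rule directed_set_path[of F])
    show "F \<subseteq> mor \<Lambda>" using prefixD(1) by (auto simp: F_def)
    show "F \<noteq> {}" using F pre_prng k by blast
    show "\<beta> \<in> F" if "\<phi> \<in> F" "\<beta> \<preceq> \<phi>" for \<phi> \<beta>
      using that prefix_trans unfolding F_def by blast
    show "\<exists>\<eta>\<in>F. \<phi> \<preceq> \<eta> \<and> \<psi> \<preceq> \<eta>" if f: "\<phi> \<in> F" "\<psi> \<in> F" for \<phi> \<psi>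
    proof -
      obtain \<xi> \<zeta> where 1: "pre z \<xi>" "\<phi> \<preceq> \<alpha> \<cdot> \<xi>" "pre z \<zeta>" "\<psi> \<preceq> \<alpha> \<cdot> \<zeta>"
        using f by (auto simp: F_def)
      then obtain \<eta> where e: "pre z \<eta>" "\<xi> \<preceq> \<eta>" "\<zeta> \<preceq> \<eta>" using pre_directed k by metis
      have "\<phi> \<preceq> \<alpha> \<cdot> \<eta>" "\<psi> \<preceq> \<alpha> \<cdot> \<eta>"
        using prefix_trans[OF 1(2)] prefix_cmp_iff[OF c[OF 1(1)] c[OF e(1)]] prefix_trans[OF 1(4)]
          prefix_cmp_iff[OF c[OF 1(3)] c[OF e(1)]] e(2,3) by simp_all
      then show ?thesis using F[OF e(1)] by blast
    qed
  qed
  then obtain y where y: "kpath y" "\<And>\<phi>. pre y \<phi> \<longleftrightarrow> \<phi> \<in> F" by blast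
  have a: "pre y \<alpha>"
    using y(2) c[OF pre_prng[OF k]] pre_prng[OF k] prefixI unfolding F_def by blast
  have "shift (deg \<Lambda> \<alpha>) y = z"
  proof (rule kpath_eqI[OF kpath_shift[OF y(1) a] k])
    fix \<xi>
    show "pre (shift (deg \<Lambda> \<alpha>) y) \<xi> \<longleftrightarrow> pre z \<xi>"
      unfolding pre_shift_iff[OF y(1) a] y(2)
      using F c prefix_cmp_iff pre_prefix[OF k] unfolding F_def by blast
  qed
  then show ?thesis using y(1) a by blast
qed

text \<open>The definite description in \<open>prepend\<close> is justified here: a path with the
  required shift exists, it inherits the boundary condition from z, and its initial segments are
  forced. Uniqueness holds among all paths, so later no boundary condition has to be checked for
  y.\<close>

lemma prepend_props:
  assumes fa: "finitely_aligned \<Lambda>" and \<alpha>: "\<alpha> \<in> mor \<Lambda>" and z: "z \<in> boundary_paths_at \<Lambda> (src \<Lambda> \<alpha>)"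
  shows "prepend \<Lambda> \<alpha> z \<in> boundary_paths \<Lambda>" "pre (prepend \<Lambda> \<alpha> z) \<alpha>"
    "shift (deg \<Lambda> \<alpha>) (prepend \<Lambda> \<alpha> z) = z"
    and prepend_unique: "kpath y \<Longrightarrow> pre y \<alpha> \<Longrightarrow> shift (deg \<Lambda> \<alpha>) y = z \<Longrightarrow> prepend \<Lambda> \<alpha> z = y"
proof -
  obtain y0 where y0: "kpath y0" "pre y0 \<alpha>" "shift (deg \<Lambda> \<alpha>) y0 = z"
    using ex_extension[OF \<alpha> z] by blast
  have b: "y0 \<in> boundary_paths \<Lambda>"
    using boundary_if_shift_boundary[OF fa y0(1,2)] y0(3) boundary_paths_atD(1)[OF z] by simp
  have u: "y = y0" if "kpath y" "pre y \<alpha>" "shift (deg \<Lambda> \<alpha>) y = z" for y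
    using kpath_eqI pre_iff_of_shift that y0 by metis
  have eq: "prepend \<Lambda> \<alpha> z = y0"
    unfolding prepend_def
  proof (rule the_equality)
    show "y0 \<in> boundary_paths \<Lambda> \<and> env (deg \<Lambda> \<alpha>) \<le> pdeg y0 \<and> pval y0 0 (deg \<Lambda> \<alpha>) = \<alpha> \<and>
        shift (deg \<Lambda> \<alpha>) y0 = z"
      using b y0(3) preD(2,3)[OF y0(2)] by blast
    show "y = y0" if "y \<in> boundary_paths \<Lambda> \<and> env (deg \<Lambda> \<alpha>) \<le> pdeg y \<and> pval y 0 (deg \<Lambda> \<alpha>) = \<alpha> \<and>
        shift (deg \<Lambda> \<alpha>) y = z" for y
      using that u boundaryD(1) \<alpha> unfolding pre_def by blast
  qed
  show "prepend \<Lambda> \<alpha> z \<in> boundary_paths \<Lambda>" "pre (prepend \<Lambda> \<alpha> z) \<alpha>"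
    "shift (deg \<Lambda> \<alpha>) (prepend \<Lambda> \<alpha> z) = z"
    "kpath y \<Longrightarrow> pre y \<alpha> \<Longrightarrow> shift (deg \<Lambda> \<alpha>) y = z \<Longrightarrow> prepend \<Lambda> \<alpha> z = y"
    unfolding eq using b y0 u by blast+
qed

lemma pre_prepend_iff:
  assumes "finitely_aligned \<Lambda>" "\<alpha> \<in> mor \<Lambda>" "z \<in> boundary_paths_at \<Lambda> (src \<Lambda> \<alpha>)"
  shows "pre (prepend \<Lambda> \<alpha> z) \<phi> \<longleftrightarrow> (\<exists>\<xi>. pre z \<xi> \<and> \<phi> \<preceq> \<alpha> \<cdot> \<xi>)"
  using pre_iff_of_shift[of "prepend \<Lambda> \<alpha> z" \<alpha>] prepend_props[OF assms] boundaryD(1) by simp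

lemma pre_prepend_cmp_iff:
  assumes "finitely_aligned \<Lambda>" "\<alpha> \<bowtie> \<xi>" "z \<in> boundary_paths_at \<Lambda> (src \<Lambda> \<alpha>)"
  shows "pre (prepend \<Lambda> \<alpha> z) (\<alpha> \<cdot> \<xi>) \<longleftrightarrow> pre z \<xi>"
  using pre_shift_iff[of "prepend \<Lambda> \<alpha> z" \<alpha> \<xi>] prepend_props[OF assms(1) composableD(1)[OF assms(2)] assms(3)]
    assms(2) boundaryD(1) by simp

lemma prepend_at:
  assumes "finitely_aligned \<Lambda>" "\<alpha> \<in> mor \<Lambda>" "z \<in> boundary_paths_at \<Lambda> (src \<Lambda> \<alpha>)"
  shows "prepend \<Lambda> \<alpha> z \<in> boundary_paths_at \<Lambda> (rng \<Lambda> \<alpha>)"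
  using prepend_props[OF assms] kpath_vertex(2) boundaryD(1) by (simp add: boundary_paths_at_def)

lemma shift_at:
  assumes "y \<in> boundary_paths \<Lambda>" "pre y \<alpha>"
  shows "shift (deg \<Lambda> \<alpha>) y \<in> boundary_paths_at \<Lambda> (src \<Lambda> \<alpha>)"
proof -
  note k = boundaryD(1)[OF assms(1)]
  have "pre (shift (deg \<Lambda> \<alpha>) y) (prng (shift (deg \<Lambda> \<alpha>) y))"
    using pre_prng kpath_shift[OF k assms(2)] .
  then have "src \<Lambda> \<alpha> = rng \<Lambda> (prng (shift (deg \<Lambda> \<alpha>) y))"
    using pre_shift_iff[OF k assms(2)] by (simp add: composable_def)
  then show ?thesis
    using shift_boundary[OF assms] prng_vertex[OF kpath_shift[OF k assms(2)]] vertsD(3)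
    by (simp add: boundary_paths_at_def)
qed

lemma prepend_shift:
  assumes "finitely_aligned \<Lambda>" "y \<in> boundary_paths \<Lambda>" "pre y \<alpha>"
  shows "prepend \<Lambda> \<alpha> (shift (deg \<Lambda> \<alpha>) y) = y"
  using prepend_unique[OF assms(1) preD(1)[OF assms(3)] shift_at[OF assms(2,3)]] boundaryD(1)[OF assms(2)]
    assms(3) by simp

text \<open>Both paths have as initial segments the prefixes of the \<alpha>\<beta>\<zeta>, with
  \<zeta> an initial segment of z. It serves to write \<alpha>y as (\<alpha>\<mu>)w when y =
  \<mu>w.\<close>

lemma prepend_prepend:
  assumes fa: "finitely_aligned \<Lambda>" and ab: "\<alpha> \<bowtie> \<beta>" and z: "z \<in> boundary_paths_at \<Lambda> (src \<Lambda> \<beta>)"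
  shows "prepend \<Lambda> \<alpha> (prepend \<Lambda> \<beta> z) = prepend \<Lambda> (\<alpha> \<cdot> \<beta>) z" (is "?l = ?r")
proof -
  note c = composableD[OF ab]
  have z': "z \<in> boundary_paths_at \<Lambda> (src \<Lambda> (\<alpha> \<cdot> \<beta>))" using z c by simp
  have b: "prepend \<Lambda> \<beta> z \<in> boundary_paths_at \<Lambda> (src \<Lambda> \<alpha>)" using prepend_at[OF fa c(2) z] c(3) by simp
  show ?thesis
  proof (rule kpath_eqI)
    show "kpath ?l" "kpath ?r"
      using prepend_props(1)[OF fa c(1) b] prepend_props(1)[OF fa c(4) z'] boundaryD(1) by auto
    fix \<phi>
    have zc: "\<beta> \<bowtie> \<xi>" if "pre z \<xi>" for \<xi>
      using that c(2) boundary_paths_atD(5)[OF z] preD(1) by (simp add: composable_def)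
    have bc: "\<alpha> \<bowtie> \<xi>" if "pre (prepend \<Lambda> \<beta> z) \<xi>" for \<xi>
      using that c(1) boundary_paths_atD(5)[OF b] preD(1) by (simp add: composable_def)
    show "pre ?l \<phi> \<longleftrightarrow> pre ?r \<phi>"
    proof
      assume "pre ?l \<phi>"
      then obtain \<xi> \<zeta> where *: "pre (prepend \<Lambda> \<beta> z) \<xi>" "\<phi> \<preceq> \<alpha> \<cdot> \<xi>" "pre z \<zeta>" "\<xi> \<preceq> \<beta> \<cdot> \<zeta>"
        using pre_prepend_iff[OF fa c(1) b] pre_prepend_iff[OF fa c(2) z] by blast
      note as = composable_assoc[OF ab zc[OF *(3)]]
      have "\<phi> \<preceq> \<alpha> \<cdot> \<beta> \<cdot> \<zeta>"
        using prefix_trans[OF *(2)] prefix_cmp_iff[OF bc[OF *(1)] as(2)] *(4) as(3) by simp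
      then show "pre ?r \<phi>" using pre_prepend_iff[OF fa c(4) z'] *(3) by blast
    next
      assume "pre ?r \<phi>"
      then obtain \<zeta> where *: "pre z \<zeta>" "\<phi> \<preceq> \<alpha> \<cdot> \<beta> \<cdot> \<zeta>"
        using pre_prepend_iff[OF fa c(4) z'] by blast
      note as = composable_assoc[OF ab zc[OF *(1)]]
      have "pre (prepend \<Lambda> \<beta> z) (\<beta> \<cdot> \<zeta>)" using pre_prepend_cmp_iff[OF fa zc[OF *(1)] z] *(1) by simp
      then show "pre ?l \<phi>" using pre_prepend_iff[OF fa c(1) b] *(2) as(3) by metis
    qed
  qed
qed

lemma prepend_vertex:
  assumes "finitely_aligned \<Lambda>" "z \<in> boundary_paths_at \<Lambda> v"
  shows "prepend \<Lambda> v z = z"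
proof -
  note D = boundary_paths_atD[OF assms(2)] and V = vertsD[OF boundary_paths_atD(4)[OF assms(2)]]
  have p: "pre z v" using pre_prng[OF D(2)] D(3) by simp
  have "shift (deg \<Lambda> v) z = z"
  proof (rule kpath_eqI[OF kpath_shift[OF D(2) p] D(2)])
    fix \<xi>
    show "pre (shift (deg \<Lambda> v) z) \<xi> \<longleftrightarrow> pre z \<xi>"
      unfolding pre_shift_iff[OF D(2) p]
      using V D(5) id_left preD(1) composableD(2,3) composableI by metis
  qed
  then show ?thesis using prepend_shift[OF assms(1) D(1) p] by simp
qed


section \<open>Generic boundary paths\<close>

text \<open>Cofinality for the prefix order. The paths with an initial segment in such a D form a
  union of cylinders that meets every cylinder.\<close>

definition dense_set :: "'a set \<Rightarrow> bool" where
  "dense_set D \<longleftrightarrow> (\<forall>\<mu>\<in>mor \<Lambda>. \<exists>\<phi>\<in>D. \<mu> \<preceq> \<phi>)"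

text \<open>Dependent choice with bookkeeping: at each stage the current morphism is extended into
  one prescribed dense set, and each set is prescribed at arbitrarily late stages.\<close>

lemma dense_sequence:
  assumes "countable \<D>" "\<And>D. D \<in> \<D> \<Longrightarrow> dense_set D" "\<mu> \<in> mor \<Lambda>"
  shows "\<exists>f :: nat \<Rightarrow> 'a. f 0 = \<mu> \<and> (\<forall>i j. i \<le> j \<longrightarrow> f i \<preceq> f j) \<and> (\<forall>D\<in>\<D>. \<forall>j. \<exists>i\<ge>j. f i \<in> D)"
proof -
  \<comment> \<open>Adding the dense set of all morphisms makes the family non-empty, so that it can
    be enumerated.\<close>
  define \<D>' where "\<D>' = insert (mor \<Lambda>) \<D>"
  have D': "countable \<D>'" "\<D>' \<noteq> {}" "\<And>D. D \<in> \<D>' \<Longrightarrow> dense_set D"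
    using assms prefix_refl by (auto simp: \<D>'_def dense_set_def)
  define g where "g j = from_nat_into \<D>' (fst (prod_decode j))" for j
  have g: "dense_set (g j)" for j
    unfolding g_def by (rule D'(3)[OF from_nat_into[OF D'(2)]])
  have "\<exists>f. \<forall>n. (f n \<in> mor \<Lambda> \<and> (n = 0 \<longrightarrow> f n = \<mu>)) \<and> (f n \<preceq> f (Suc n) \<and> f (Suc n) \<in> g n)"
  proof (rule dependent_nat_choice)
    show "\<exists>x. x \<in> mor \<Lambda> \<and> ((0::nat) = 0 \<longrightarrow> x = \<mu>)" using assms(3) by blast
    fix x and n :: nat assume "x \<in> mor \<Lambda> \<and> (n = 0 \<longrightarrow> x = \<mu>)"
    then obtain y where "y \<in> g n" "x \<preceq> y" using g unfolding dense_set_def by blast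
    then show "\<exists>y. (y \<in> mor \<Lambda> \<and> (Suc n = 0 \<longrightarrow> y = \<mu>)) \<and> (x \<preceq> y \<and> y \<in> g n)"
      using prefixD(2) by blast
  qed
  then obtain f where f: "f 0 = \<mu>" "\<And>n. f n \<in> mor \<Lambda>" "\<And>n. f n \<preceq> f (Suc n)" "\<And>n. f (Suc n) \<in> g n"
    by blast
  show ?thesis
  proof (intro exI[of _ f] conjI allI impI ballI)
    show "f 0 = \<mu>" by (rule f(1))
    fix i j :: nat assume "i \<le> j"
    then show "f i \<preceq> f j"
      by (induction rule: dec_induct) (use f prefix_refl prefix_trans in blast)+
  next
    fix D and j :: nat assume "D \<in> \<D>"
    then have "D \<in> \<D>'" by (simp add: \<D>'_def)
    then obtain a where "from_nat_into \<D>' a = D" using D'(1) from_nat_into_surj by metis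
    then have "g (prod_encode (a, j)) = D" by (simp add: g_def)
    moreover have "j \<le> Suc (prod_encode (a, j))" using le_prod_encode_2 le_SucI by blast
    ultimately show "\<exists>i\<ge>j. f i \<in> D" using f(4) by blast
  qed
qed

text \<open>The category argument. Each instance of the boundary condition is itself a dense
  requirement, and there are countably many of them; an increasing sequence that meets them and the
  given sets has as its prefixes the initial segments of the desired path.\<close>

lemma generic_boundary_path:
  assumes "countable \<D>" "\<And>D. D \<in> \<D> \<Longrightarrow> dense_set D" "v \<in> verts \<Lambda>"
  obtains x where "x \<in> boundary_paths_at \<Lambda> v" "\<And>D. D \<in> \<D> \<Longrightarrow> \<exists>\<phi>\<in>D. pre x \<phi>"
proof -
  \<comment> \<open>The requirement for \<phi> and E: once \<phi> has been passed, some
    \<phi>\<beta> with \<beta> \<in> E has been passed too.\<close>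
  define T where "T = (\<lambda>(\<phi>, E). {\<mu> \<in> mor \<Lambda>. \<phi> \<preceq> \<mu> \<longrightarrow> (\<exists>\<beta>\<in>E. \<phi> \<cdot> \<beta> \<preceq> \<mu>)})"
  define I where "I = {(\<phi>, E). \<phi> \<in> mor \<Lambda> \<and> E \<in> FE \<Lambda> (src \<Lambda> \<phi>)}"
  \<comment> \<open>A countable set has only countably many finite subsets, so there are countably
    many requirements.\<close>
  have "I \<subseteq> mor \<Lambda> \<times> {E. finite E \<and> E \<subseteq> mor \<Lambda>}"
    by (auto simp: I_def FE_def out_of_def)
  then have "countable I"
    using countable_mor countable_Collect_finite_subset countable_SIGMA countable_subset by metis
  moreover have "dense_set (T p)" if pI: "p \<in> I" for p
  proof -
    obtain \<phi> E where p: "p = (\<phi>, E)" "\<phi> \<in> mor \<Lambda>" "E \<in> FE \<Lambda> (src \<Lambda> \<phi>)"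
      using pI by (auto simp: I_def)
    have E: "exhaustive \<Lambda> (src \<Lambda> \<phi>) E" "E \<subseteq> out_of \<Lambda> (src \<Lambda> \<phi>)"
      using p(3) by (auto simp: FE_def)
    show ?thesis
      unfolding dense_set_def
    proof
      fix \<mu> assume m: "\<mu> \<in> mor \<Lambda>"
      show "\<exists>\<mu>'\<in>T p. \<mu> \<preceq> \<mu>'"
      proof (cases "\<phi> \<preceq> \<mu>")
        case False
        then show ?thesis using m prefix_refl by (auto simp: T_def p)
      next
        case True
        then obtain \<nu> where n: "\<phi> \<bowtie> \<nu>" "\<mu> = \<phi> \<cdot> \<nu>" by (rule prefixE)
        then have "\<nu> \<in> out_of \<Lambda> (src \<Lambda> \<phi>)" by (simp add: out_of_def composable_def)
        \<comment> \<open>Density: exhaustiveness of E extends \<nu> to some \<nu>\<rho> that begins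
          with a member of E.\<close>
        then obtain \<beta> \<rho> \<tau> where b: "\<beta> \<in> E" "(\<rho>, \<tau>) \<in> Lmin \<Lambda> \<nu> \<beta>"
          using E(1) unfolding exhaustive_def by fastforce
        have pb: "\<phi> \<bowtie> \<beta>" using b(1) E(2) p(2) by (auto simp: out_of_def composable_def)
        have r: "\<nu> \<bowtie> \<rho>" "\<beta> \<bowtie> \<tau>" "\<nu> \<cdot> \<rho> = \<beta> \<cdot> \<tau>"
          using Lmin_iff[of \<rho> \<tau> \<nu> \<beta>] b(2) composableD(2)[OF n(1)] composableD(2)[OF pb] by auto
        have "\<mu> \<preceq> \<phi> \<cdot> (\<nu> \<cdot> \<rho>)" "\<phi> \<cdot> \<beta> \<preceq> \<phi> \<cdot> (\<nu> \<cdot> \<rho>)"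
          using n r pb composable_assoc prefixI by metis+
        then have "\<phi> \<cdot> (\<nu> \<cdot> \<rho>) \<in> T p" using b(1) prefixD(2) by (auto simp: T_def p)
        then show ?thesis using \<open>\<mu> \<preceq> \<phi> \<cdot> (\<nu> \<cdot> \<rho>)\<close> by blast
      qed
    qed
  qed
  ultimately have "countable (\<D> \<union> T ` I)" "\<And>D. D \<in> \<D> \<union> T ` I \<Longrightarrow> dense_set D"
    using assms(1,2) by auto
  from dense_sequence[OF this vertsD(1)[OF assms(3)]]
  obtain f :: "nat \<Rightarrow> 'a" where f': "f 0 = v \<and> (\<forall>i j. i \<le> j \<longrightarrow> f i \<preceq> f j) \<and>
      (\<forall>D\<in>\<D> \<union> T ` I. \<forall>j. \<exists>i\<ge>j. f i \<in> D)"
    by (rule exE)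
  have f: "f 0 = v" "\<And>i j. i \<le> j \<Longrightarrow> f i \<preceq> f j" "\<And>D j. D \<in> \<D> \<union> T ` I \<Longrightarrow> \<exists>i\<ge>j. f i \<in> D"
    using f' by simp_all
  define F where "F = {\<phi>. \<exists>j. \<phi> \<preceq> f j}"
  have fF: "f j \<in> F" for j using f(2)[of j j] by (auto simp: F_def)
  have "\<exists>x. kpath x \<and> (\<forall>\<phi>. pre x \<phi> \<longleftrightarrow> \<phi> \<in> F)"
  proof (rule directed_set_path)
    show "F \<subseteq> mor \<Lambda>" using prefixD(1) by (auto simp: F_def)
    show "F \<noteq> {}" using fF by blast
    show "\<alpha> \<in> F" if "\<phi> \<in> F" "\<alpha> \<preceq> \<phi>" for \<phi> \<alpha>
      using that prefix_trans unfolding F_def by blast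
    show "\<exists>\<eta>\<in>F. \<phi> \<preceq> \<eta> \<and> \<psi> \<preceq> \<eta>" if fp: "\<phi> \<in> F" "\<psi> \<in> F" for \<phi> \<psi>
    proof -
      obtain i j where "\<phi> \<preceq> f i" "\<psi> \<preceq> f j" using fp by (auto simp: F_def)
      then have "\<phi> \<preceq> f (max i j)" "\<psi> \<preceq> f (max i j)"
        using f(2) prefix_trans max.cobounded1 max.cobounded2 by meson+
      then show ?thesis using fF by blast
    qed
  qed
  then obtain x where x: "kpath x" "\<And>\<phi>. pre x \<phi> \<longleftrightarrow> \<phi> \<in> F" by blast
  have "x \<in> boundary_paths \<Lambda>"
    unfolding boundary_iff
  proof (intro conjI allI impI ballI)
    show "kpath x" by fact
    fix \<phi> E assume p: "pre x \<phi>" and E: "E \<in> FE \<Lambda> (src \<Lambda> \<phi>)"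
    then obtain j where j: "\<phi> \<preceq> f j" using x(2) by (auto simp: F_def)
    have "T (\<phi>, E) \<in> \<D> \<union> T ` I" using preD(1)[OF p] E by (auto simp: I_def)
    \<comment> \<open>The bound i \<ge> j matters: an earlier f i could belong to the set merely for
      not extending \<phi>.\<close>
    then obtain i where i: "i \<ge> j" "f i \<in> T (\<phi>, E)" using f(3) by blast
    have "\<phi> \<preceq> f i" using j f(2)[OF i(1)] prefix_trans by blast
    then show "\<exists>\<beta>\<in>E. pre x (\<phi> \<cdot> \<beta>)" using i(2) x(2) by (auto simp: T_def F_def)
  qed
  moreover have "prng x = v"
    using kpath_vertex(2)[OF x(1)] x(2) fF f(1) vertsD(3)[OF assms(3)] by metis
  ultimately have "x \<in> boundary_paths_at \<Lambda> v" by (simp add: boundary_paths_at_def)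
  moreover have "\<exists>\<phi>\<in>D. pre x \<phi>" if "D \<in> \<D>" for D
    using f(3)[of D 0] that x(2) fF by blast
  ultimately show ?thesis using that by blast
qed

lemma boundary_path_ex:
  assumes "v \<in> verts \<Lambda>"
  obtains x where "x \<in> boundary_paths_at \<Lambda> v"
  using generic_boundary_path[of "{}" v] assms by auto

lemma boundary_path_through:
  assumes "finitely_aligned \<Lambda>" "\<mu> \<in> mor \<Lambda>"
  obtains y where "y \<in> boundary_paths \<Lambda>" "pre y \<mu>"
  using boundary_path_ex[OF src_in_verts[OF assms(2)]] prepend_props[OF assms] by metis


section \<open>Neighbourhoods of boundary paths\<close>

text \<open>\<open>P\<close> holds near \<open>z\<close>; the topology of \<open>\<partial>\<Lambda>\<close> enters only through this predicate.\<close>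

definition locally_at :: "('a, 'k) kpath \<Rightarrow> (('a, 'k) kpath \<Rightarrow> bool) \<Rightarrow> bool" where
  "locally_at z P \<longleftrightarrow> (\<exists>A B. finite A \<and> finite B \<and> B \<subseteq> mor \<Lambda> \<and>
     (\<forall>\<phi>\<in>A. pre z \<phi>) \<and> (\<forall>\<phi>\<in>B. \<not> pre z \<phi>) \<and>
     (\<forall>y\<in>boundary_paths \<Lambda>. (\<forall>\<phi>\<in>A. pre y \<phi>) \<longrightarrow> (\<forall>\<phi>\<in>B. \<not> pre y \<phi>) \<longrightarrow> P y))"

lemma locally_atI:
  assumes "finite A" "finite B" "B \<subseteq> mor \<Lambda>" "\<And>\<phi>. \<phi> \<in> A \<Longrightarrow> pre z \<phi>" "\<And>\<phi>. \<phi> \<in> B \<Longrightarrow> \<not> pre z \<phi>"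
    "\<And>y. y \<in> boundary_paths \<Lambda> \<Longrightarrow> (\<And>\<phi>. \<phi> \<in> A \<Longrightarrow> pre y \<phi>) \<Longrightarrow> (\<And>\<phi>. \<phi> \<in> B \<Longrightarrow> \<not> pre y \<phi>) \<Longrightarrow> P y"
  shows "locally_at z P"
  unfolding locally_at_def using assms by (intro exI[of _ A] exI[of _ B]) blast

lemma locally_atE:
  assumes "locally_at z P"
  obtains A B where "finite A" "finite B" "B \<subseteq> mor \<Lambda>" "\<forall>\<phi>\<in>A. pre z \<phi>" "\<forall>\<phi>\<in>B. \<not> pre z \<phi>"
    "\<forall>y\<in>boundary_paths \<Lambda>. (\<forall>\<phi>\<in>A. pre y \<phi>) \<longrightarrow> (\<forall>\<phi>\<in>B. \<not> pre y \<phi>) \<longrightarrow> P y"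
  using assms unfolding locally_at_def
  by (elim exE conjE) (rule that)

lemma locally_at_mono:
  assumes "locally_at z P" "\<And>y. y \<in> boundary_paths \<Lambda> \<Longrightarrow> P y \<Longrightarrow> Q y"
  shows "locally_at z Q"
proof -
  from assms(1) obtain A B where P: "finite A" "finite B" "B \<subseteq> mor \<Lambda>" "\<forall>\<phi>\<in>A. pre z \<phi>" "\<forall>\<phi>\<in>B. \<not> pre z \<phi>"
    "\<forall>y\<in>boundary_paths \<Lambda>. (\<forall>\<phi>\<in>A. pre y \<phi>) \<longrightarrow> (\<forall>\<phi>\<in>B. \<not> pre y \<phi>) \<longrightarrow> P y"
    by (rule locally_atE)
  show ?thesis
    by (rule locally_atI[of A B]) (use P assms(2) in simp_all)
qed

lemma locally_at_conj:
  assumes "locally_at z P" "locally_at z Q"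
  shows "locally_at z (\<lambda>y. P y \<and> Q y)"
proof -
  from assms(1) obtain A B where P: "finite A" "finite B" "B \<subseteq> mor \<Lambda>" "\<forall>\<phi>\<in>A. pre z \<phi>" "\<forall>\<phi>\<in>B. \<not> pre z \<phi>"
    "\<forall>y\<in>boundary_paths \<Lambda>. (\<forall>\<phi>\<in>A. pre y \<phi>) \<longrightarrow> (\<forall>\<phi>\<in>B. \<not> pre y \<phi>) \<longrightarrow> P y"
    by (rule locally_atE)
  from assms(2) obtain A' B' where Q: "finite A'" "finite B'" "B' \<subseteq> mor \<Lambda>" "\<forall>\<phi>\<in>A'. pre z \<phi>" "\<forall>\<phi>\<in>B'. \<not> pre z \<phi>"
    "\<forall>y\<in>boundary_paths \<Lambda>. (\<forall>\<phi>\<in>A'. pre y \<phi>) \<longrightarrow> (\<forall>\<phi>\<in>B'. \<not> pre y \<phi>) \<longrightarrow> Q y"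
    by (rule locally_atE)
  show ?thesis
    by (rule locally_atI[of "A \<union> A'" "B \<union> B'"]) (use P Q in auto)
qed

lemma locally_at_pre: "pre z \<phi> \<Longrightarrow> locally_at z (\<lambda>y. pre y \<phi>)"
  by (rule locally_atI[of "{\<phi>}" "{}"]) auto

lemma locally_at_ball:
  assumes "finite G" "\<And>\<nu>. \<nu> \<in> G \<Longrightarrow> locally_at z (P \<nu>)"
  shows "locally_at z (\<lambda>y. \<forall>\<nu>\<in>G. P \<nu> y)"
  using assms
proof (induction G)
  case empty show ?case by (rule locally_atI[of "{}" "{}"]) auto
next
  case (insert \<nu> G)
  then show ?case using locally_at_conj[of z "P \<nu>" "\<lambda>y. \<forall>\<nu>\<in>G. P \<nu> y"] by simp
qed

lemma pre_upper_bound: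
  assumes "kpath z" "finite A" "\<And>\<phi>. \<phi> \<in> A \<Longrightarrow> pre z \<phi>"
  obtains \<mu> where "pre z \<mu>" "\<And>\<phi>. \<phi> \<in> A \<Longrightarrow> \<phi> \<preceq> \<mu>"
proof -
  have "\<exists>\<mu>. pre z \<mu> \<and> (\<forall>\<phi>\<in>A. \<phi> \<preceq> \<mu>)"
    using assms(2,3)
  proof (induction A)
    case empty then show ?case using pre_prng[OF assms(1)] by blast
  next
    case (insert \<phi> A)
    then obtain \<mu> where "pre z \<mu>" "\<forall>\<phi>\<in>A. \<phi> \<preceq> \<mu>" by auto
    moreover obtain \<eta> where "pre z \<eta>" "\<phi> \<preceq> \<eta>" "\<mu> \<preceq> \<eta>"
      using pre_directed[OF assms(1)] insert.prems calculation(1) by blast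
    ultimately show ?case using prefix_trans by blast
  qed
  then show ?thesis using that by blast
qed

text \<open>Here the boundary condition is decisive. Let \<mu> bound A. The minimal extensions of
  \<mu> by members of B form a finite set that z avoids, so this set is not exhaustive, and a
  witness \<nu> of that has no common extension with it. The cylinder of \<mu>\<nu> then lies in the
  neighbourhood, though it need not contain z.\<close>

lemma locally_at_cylinder:
  assumes fa: "finitely_aligned \<Lambda>" and z: "z \<in> boundary_paths \<Lambda>" and "locally_at z P"
  shows "\<exists>\<mu>\<in>mor \<Lambda>. rng \<Lambda> \<mu> = prng z \<and> (\<forall>y\<in>boundary_paths \<Lambda>. pre y \<mu> \<longrightarrow> P y)"
proof -
  from assms(3) obtain A B where P: "finite A" "finite B" "B \<subseteq> mor \<Lambda>" "\<forall>\<phi>\<in>A. pre z \<phi>" "\<forall>\<phi>\<in>B. \<not> pre z \<phi>"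
    "\<forall>y\<in>boundary_paths \<Lambda>. (\<forall>\<phi>\<in>A. pre y \<phi>) \<longrightarrow> (\<forall>\<phi>\<in>B. \<not> pre y \<phi>) \<longrightarrow> P y"
    by (rule locally_atE)
  note k = boundaryD(1)[OF z]
  obtain \<mu> where m: "pre z \<mu>" "\<And>\<phi>. \<phi> \<in> A \<Longrightarrow> \<phi> \<preceq> \<mu>"
    using pre_upper_bound[OF k P(1)] P(4) by blast
  note mm = preD(1)[OF m(1)]
  \<comment> \<open>A path that starts with \<mu> has an initial segment in B exactly when it starts
    with some \<mu>\<rho>, \<rho> \<in> G.\<close>
  define G where "G = (\<Union>\<phi>\<in>B. fst ` Lmin \<Lambda> \<mu> \<phi>)"
  have G: "\<exists>\<tau>. \<exists>\<phi>\<in>B. \<mu> \<bowtie> \<rho> \<and> \<phi> \<bowtie> \<tau> \<and> \<mu> \<cdot> \<rho> = \<phi> \<cdot> \<tau>" if r: "\<rho> \<in> G" for \<rho>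
  proof -
    obtain \<phi> \<tau> where "\<phi> \<in> B" "(\<rho>, \<tau>) \<in> Lmin \<Lambda> \<mu> \<phi>" using r by (auto simp: G_def)
    then show ?thesis using Lmin_iff[of \<rho> \<tau> \<mu> \<phi>] mm P(3) by blast
  qed
  have not_pre: "\<not> pre z (\<mu> \<cdot> \<rho>)" if "\<rho> \<in> G" for \<rho>
    using G[OF that] P(5) pval_cmp(1)[OF k] by metis
  have fin: "finite G" using P(2,3) fa mm by (auto simp: G_def finitely_aligned_def)
  have sub: "G \<subseteq> out_of \<Lambda> (src \<Lambda> \<mu>)" using G by (fastforce simp: out_of_def composable_def)
  \<comment> \<open>With the identity excluded, exhaustiveness would put G into \<open>FE\<close>,
    and z would have to start with some \<mu>\<rho>.\<close>
  have "src \<Lambda> \<mu> \<notin> G" using not_pre m(1) id_right[OF mm] by force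
  then have "\<not> exhaustive \<Lambda> (src \<Lambda> \<mu>) G"
    using boundaryD(2)[OF z m(1), of G] not_pre fin sub src_in_verts[OF mm] unfolding FE_def by blast
  then obtain \<nu> where n: "\<nu> \<in> out_of \<Lambda> (src \<Lambda> \<mu>)" "\<And>\<rho>. \<rho> \<in> G \<Longrightarrow> Lmin \<Lambda> \<nu> \<rho> = {}"
    using sub unfolding exhaustive_def by blast
  have mn: "\<mu> \<bowtie> \<nu>" using n(1) mm by (simp add: out_of_def composable_def)
  show ?thesis
  proof (intro bexI[of _ "\<mu> \<cdot> \<nu>"] conjI ballI impI)
    show "\<mu> \<cdot> \<nu> \<in> mor \<Lambda>" using composableD(4)[OF mn] .
    show "rng \<Lambda> (\<mu> \<cdot> \<nu>) = prng z" using composableD(5)[OF mn] kpath_vertex(2)[OF k m(1)] by simp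
    fix y assume y: "y \<in> boundary_paths \<Lambda>" "pre y (\<mu> \<cdot> \<nu>)"
    note ky = boundaryD(1)[OF y(1)]
    have "pre y \<phi>" if "\<phi> \<in> A" for \<phi>
      using pre_prefix[OF ky y(2)] prefix_trans[OF m(2)[OF that] prefixI[OF mn]] by blast
    moreover have "\<not> pre y \<phi>" if "\<phi> \<in> B" for \<phi>
    proof
      assume "pre y \<phi>"
      then obtain \<eta> where e: "\<mu> \<cdot> \<nu> \<preceq> \<eta>" "\<phi> \<preceq> \<eta>" using pre_directed[OF ky y(2)] by metis
      obtain \<xi> where x: "\<mu> \<cdot> \<nu> \<bowtie> \<xi>" "\<eta> = \<mu> \<cdot> \<nu> \<cdot> \<xi>" using e(1) by (rule prefixE)
      have nx: "\<nu> \<bowtie> \<xi>" using x(1) composable_cmp_left[OF mn] by simp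
      note as = composable_assoc[OF mn nx]
      have "\<phi> \<preceq> \<mu> \<cdot> (\<nu> \<cdot> \<xi>)" using e(2) x(2) as(3) by simp
      then obtain \<rho> \<tau> where r: "(\<rho>, \<tau>) \<in> Lmin \<Lambda> \<mu> \<phi>" "\<rho> \<preceq> \<nu> \<cdot> \<xi>"
        using common_extension_Lmin[OF as(2)] by metis
      have "\<rho> \<in> G" using r(1) that unfolding G_def by force
      then show False using n(2) common_extension_Lmin[OF nx r(2)] by blast
    qed
    ultimately show "P y" using P(6) y(1) by blast
  qed
qed

section \<open>Continuity of prepending\<close>

lemma locally_at_boundary_paths_at:
  assumes "z \<in> boundary_paths_at \<Lambda> v"
  shows "locally_at z (\<lambda>y. y \<in> boundary_paths_at \<Lambda> v)"
proof -
  note D = boundary_paths_atD[OF assms]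
  have "locally_at z (\<lambda>y. pre y v)" using locally_at_pre pre_prng[OF D(2)] D(3) by metis
  then show ?thesis
  proof (rule locally_at_mono)
    fix y assume y: "y \<in> boundary_paths \<Lambda>" "pre y v"
    then show "y \<in> boundary_paths_at \<Lambda> v"
      using kpath_vertex(2) boundaryD(1) vertsD(3)[OF D(4)] by (simp add: boundary_paths_at_def)
  qed
qed

text \<open>One initial segment \<xi> of z witnesses the condition, and it does so for every y that
  starts with \<xi>.\<close>

lemma locally_at_pre_prepend:
  assumes fa: "finitely_aligned \<Lambda>" and a: "\<alpha> \<in> mor \<Lambda>" and z: "z \<in> boundary_paths_at \<Lambda> (src \<Lambda> \<alpha>)"
    and p: "pre (prepend \<Lambda> \<alpha> z) \<phi>"
  shows "locally_at z (\<lambda>y. pre (prepend \<Lambda> \<alpha> y) \<phi>)"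
proof -
  obtain \<xi> where x: "pre z \<xi>" "\<phi> \<preceq> \<alpha> \<cdot> \<xi>" using p pre_prepend_iff[OF fa a z] by blast
  show ?thesis
    using locally_at_conj[OF locally_at_boundary_paths_at[OF z] locally_at_pre[OF x(1)]]
    by (rule locally_at_mono) (use pre_prepend_iff[OF fa a] x(2) in blast)
qed

text \<open>\<phi> is an initial segment of \<alpha>y iff y starts with the first component of some
  member of \<open>Lmin\<close> for \<alpha> and \<phi>. Finite alignment thus turns the negation
  into finitely many exclusions.\<close>

lemma locally_at_not_pre_prepend:
  assumes fa: "finitely_aligned \<Lambda>" and a: "\<alpha> \<in> mor \<Lambda>" and z: "z \<in> boundary_paths_at \<Lambda> (src \<Lambda> \<alpha>)"
    and f: "\<phi> \<in> mor \<Lambda>" and p: "\<not> pre (prepend \<Lambda> \<alpha> z) \<phi>"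
  shows "locally_at z (\<lambda>y. \<not> pre (prepend \<Lambda> \<alpha> y) \<phi>)"
proof -
  have L: "\<alpha> \<bowtie> \<rho> \<and> \<phi> \<preceq> \<alpha> \<cdot> \<rho>" if r: "\<rho> \<in> fst ` Lmin \<Lambda> \<alpha> \<phi>" for \<rho>
  proof -
    obtain \<tau> where "(\<rho>, \<tau>) \<in> Lmin \<Lambda> \<alpha> \<phi>" using r by auto
    then have "\<alpha> \<bowtie> \<rho>" "\<phi> \<bowtie> \<tau>" "\<alpha> \<cdot> \<rho> = \<phi> \<cdot> \<tau>" using Lmin_iff[of \<rho> \<tau> \<alpha> \<phi>] a f by blast+
    then show ?thesis using prefixI by metis
  qed
  have "locally_at z (\<lambda>y. \<forall>\<rho>\<in>fst ` Lmin \<Lambda> \<alpha> \<phi>. \<not> pre y \<rho>)"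
  proof (rule locally_atI[of "{}" "fst ` Lmin \<Lambda> \<alpha> \<phi>"])
    show "finite (fst ` Lmin \<Lambda> \<alpha> \<phi>)" using fa a f by (simp add: finitely_aligned_def)
    show "fst ` Lmin \<Lambda> \<alpha> \<phi> \<subseteq> mor \<Lambda>" using L composableD(2) by blast
    show "\<not> pre z \<rho>" if "\<rho> \<in> fst ` Lmin \<Lambda> \<alpha> \<phi>" for \<rho>
      using L[OF that] p pre_prepend_iff[OF fa a z] by blast
  qed auto
  note locally_at_conj[OF locally_at_boundary_paths_at[OF z] this]
  then show ?thesis
  proof (rule locally_at_mono)
    fix y assume y: "y \<in> boundary_paths_at \<Lambda> (src \<Lambda> \<alpha>) \<and> (\<forall>\<rho>\<in>fst ` Lmin \<Lambda> \<alpha> \<phi>. \<not> pre y \<rho>)"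
    show "\<not> pre (prepend \<Lambda> \<alpha> y) \<phi>"
    proof
      assume "pre (prepend \<Lambda> \<alpha> y) \<phi>"
      then obtain \<xi> where x: "pre y \<xi>" "\<phi> \<preceq> \<alpha> \<cdot> \<xi>" using pre_prepend_iff[OF fa a] y by blast
      have "\<alpha> \<bowtie> \<xi>" using x(1) a y boundary_paths_atD(5) preD(1) by (metis composableI)
      then obtain \<rho> \<tau> where "(\<rho>, \<tau>) \<in> Lmin \<Lambda> \<alpha> \<phi>" "\<rho> \<preceq> \<xi>"
        using common_extension_Lmin x(2) by metis
      moreover have "kpath y" using y boundary_paths_atD(2) by blast
      ultimately show False using y pre_prefix[OF _ x(1)] by force
    qed
  qed
qed


section \<open>The boundary-path groupoid\<close>

lemma bp_arrowsE:
  assumes "a \<in> bp_arrows \<Lambda>"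
  obtains \<alpha> \<beta> z where "a = (prepend \<Lambda> \<alpha> z, intv (deg \<Lambda> \<alpha>) - intv (deg \<Lambda> \<beta>), prepend \<Lambda> \<beta> z)"
    "\<alpha> \<in> mor \<Lambda>" "\<beta> \<in> mor \<Lambda>" "src \<Lambda> \<alpha> = src \<Lambda> \<beta>" "z \<in> boundary_paths_at \<Lambda> (src \<Lambda> \<alpha>)"
  using assms unfolding bp_arrows_def by blast

text \<open>Shifting recovers the two tails, so the condition on shifts makes them one common tail
  z. All further work with \<open>Zpair\<close> uses this parametrisation.\<close>

lemma Zpair_iff:
  assumes fa: "finitely_aligned \<Lambda>" and ab: "\<alpha> \<in> mor \<Lambda>" "\<beta> \<in> mor \<Lambda>" "src \<Lambda> \<alpha> = src \<Lambda> \<beta>"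
  shows "(x, m, y) \<in> Zpair \<Lambda> \<alpha> \<beta> \<longleftrightarrow> m = intv (deg \<Lambda> \<alpha>) - intv (deg \<Lambda> \<beta>) \<and>
    (\<exists>z\<in>boundary_paths_at \<Lambda> (src \<Lambda> \<alpha>). x = prepend \<Lambda> \<alpha> z \<and> y = prepend \<Lambda> \<beta> z)"
    (is "_ \<longleftrightarrow> ?m \<and> ?R")
proof
  assume "(x, m, y) \<in> Zpair \<Lambda> \<alpha> \<beta>"
  then have *: ?m "x \<in> Zpath \<Lambda> \<alpha>" "y \<in> Zpath \<Lambda> \<beta>" "shift (deg \<Lambda> \<alpha>) x = shift (deg \<Lambda> \<beta>) y"
    unfolding Zpair_def by blast+
  obtain z where z: "z \<in> boundary_paths_at \<Lambda> (src \<Lambda> \<alpha>)" "x = prepend \<Lambda> \<alpha> z"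
    using *(2) unfolding Zpath_def by blast
  obtain w where w: "w \<in> boundary_paths_at \<Lambda> (src \<Lambda> \<beta>)" "y = prepend \<Lambda> \<beta> w"
    using *(3) unfolding Zpath_def by blast
  have "z = w" using *(4) z w prepend_props(3)[OF fa] ab by simp
  then show "?m \<and> ?R" using *(1) z w by blast
next
  assume "?m \<and> ?R"
  then obtain z where *: ?m "z \<in> boundary_paths_at \<Lambda> (src \<Lambda> \<alpha>)" "x = prepend \<Lambda> \<alpha> z" "y = prepend \<Lambda> \<beta> z"
    by blast
  have z': "z \<in> boundary_paths_at \<Lambda> (src \<Lambda> \<beta>)" using *(2) ab(3) by simp
  have "(x, m, y) \<in> bp_arrows \<Lambda>" using * ab unfolding bp_arrows_def by blast
  moreover have "x \<in> Zpath \<Lambda> \<alpha>" "y \<in> Zpath \<Lambda> \<beta>" using * z' unfolding Zpath_def by blast+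
  moreover have "shift (deg \<Lambda> \<alpha>) x = shift (deg \<Lambda> \<beta>) y"
    using prepend_props(3)[OF fa ab(1) *(2)] prepend_props(3)[OF fa ab(2) z'] *(3,4) by simp
  ultimately show "(x, m, y) \<in> Zpair \<Lambda> \<alpha> \<beta>" using *(1) unfolding Zpair_def by blast
qed

text \<open>The common tail of x and y starts with \<nu> iff x starts with \<alpha>\<nu>.
  Subtracting such sets in \<open>Zminus\<close> therefore only excludes initial segments of the
  range.\<close>

lemma Zpair_extend_iff:
  assumes fa: "finitely_aligned \<Lambda>" and ab: "\<alpha> \<bowtie> \<nu>" "\<beta> \<bowtie> \<nu>"
    and Z: "(x, m, y) \<in> Zpair \<Lambda> \<alpha> \<beta>"
  shows "(x, m, y) \<in> Zpair \<Lambda> (\<alpha> \<cdot> \<nu>) (\<beta> \<cdot> \<nu>) \<longleftrightarrow> pre x (\<alpha> \<cdot> \<nu>)"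
proof -
  note a = composableD[OF ab(1)] and b = composableD[OF ab(2)]
  have s: "src \<Lambda> \<alpha> = src \<Lambda> \<beta>" "src \<Lambda> (\<alpha> \<cdot> \<nu>) = src \<Lambda> (\<beta> \<cdot> \<nu>)" using a b by simp_all
  have d: "intv (deg \<Lambda> (\<alpha> \<cdot> \<nu>)) - intv (deg \<Lambda> (\<beta> \<cdot> \<nu>)) = intv (deg \<Lambda> \<alpha>) - intv (deg \<Lambda> \<beta>)"
    using a(7) b(7) by (simp add: fun_eq_iff)
  obtain z where z: "m = intv (deg \<Lambda> \<alpha>) - intv (deg \<Lambda> \<beta>)" "z \<in> boundary_paths_at \<Lambda> (src \<Lambda> \<alpha>)"
      "x = prepend \<Lambda> \<alpha> z" "y = prepend \<Lambda> \<beta> z"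
    using Z Zpair_iff[OF fa a(1) b(1) s(1)] by blast
  show ?thesis
  proof
    assume "(x, m, y) \<in> Zpair \<Lambda> (\<alpha> \<cdot> \<nu>) (\<beta> \<cdot> \<nu>)"
    then obtain w where "w \<in> boundary_paths_at \<Lambda> (src \<Lambda> (\<alpha> \<cdot> \<nu>))" "x = prepend \<Lambda> (\<alpha> \<cdot> \<nu>) w"
      unfolding Zpair_iff[OF fa a(4) b(4) s(2)] by blast
    then show "pre x (\<alpha> \<cdot> \<nu>)"
      using prepend_props(2)[OF fa a(4)] by simp
  next
    assume "pre x (\<alpha> \<cdot> \<nu>)"
    then have p: "pre z \<nu>" using pre_prepend_cmp_iff[OF fa ab(1) z(2)] z(3) by simp
    define w where "w = shift (deg \<Lambda> \<nu>) z"
    have w: "w \<in> boundary_paths_at \<Lambda> (src \<Lambda> \<nu>)" "z = prepend \<Lambda> \<nu> w"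
      using shift_at prepend_shift[OF fa] boundary_paths_atD(1)[OF z(2)] p by (simp_all add: w_def)
    have "x = prepend \<Lambda> (\<alpha> \<cdot> \<nu>) w" "y = prepend \<Lambda> (\<beta> \<cdot> \<nu>) w"
      using prepend_prepend[OF fa _ w(1)] ab z(3,4) w(2) by simp_all
    then show "(x, m, y) \<in> Zpair \<Lambda> (\<alpha> \<cdot> \<nu>) (\<beta> \<cdot> \<nu>)"
      using Zpair_iff[OF fa a(4) b(4) s(2)] d z(1) w(1) a(6) by auto
  qed
qed

text \<open>For a long enough initial segment \<xi> of z, \<alpha>\<xi> = \<gamma>\<gamma>' and
  \<beta>\<xi> = \<delta>\<delta>'. The equal degree differences force \<gamma>' = \<delta>', so
  every y = \<xi>w gives an arrow with common tail \<gamma>'w after \<gamma> and \<delta>.\<close>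

lemma locally_at_Zpair:
  assumes fa: "finitely_aligned \<Lambda>"
    and ab: "\<alpha> \<in> mor \<Lambda>" "\<beta> \<in> mor \<Lambda>" "src \<Lambda> \<alpha> = src \<Lambda> \<beta>"
    and gd: "\<gamma> \<in> mor \<Lambda>" "\<delta> \<in> mor \<Lambda>" "src \<Lambda> \<gamma> = src \<Lambda> \<delta>"
    and z: "z \<in> boundary_paths_at \<Lambda> (src \<Lambda> \<alpha>)"
    and m: "m = intv (deg \<Lambda> \<alpha>) - intv (deg \<Lambda> \<beta>)"
    and Z: "(prepend \<Lambda> \<alpha> z, m, prepend \<Lambda> \<beta> z) \<in> Zpair \<Lambda> \<gamma> \<delta>"
  shows "locally_at z (\<lambda>y. (prepend \<Lambda> \<alpha> y, m, prepend \<Lambda> \<beta> y) \<in> Zpair \<Lambda> \<gamma> \<delta>)"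
proof -
  note k = boundary_paths_atD(2)[OF z]
  have zb: "z \<in> boundary_paths_at \<Lambda> (src \<Lambda> \<beta>)" using z ab(3) by simp
  obtain u where u: "u \<in> boundary_paths_at \<Lambda> (src \<Lambda> \<gamma>)" "prepend \<Lambda> \<alpha> z = prepend \<Lambda> \<gamma> u"
      "prepend \<Lambda> \<beta> z = prepend \<Lambda> \<delta> u"
    and m': "m = intv (deg \<Lambda> \<gamma>) - intv (deg \<Lambda> \<delta>)"
    using Z Zpair_iff[OF fa gd] by blast
  have ud: "u \<in> boundary_paths_at \<Lambda> (src \<Lambda> \<delta>)" using u(1) gd(3) by simp
  have "pre (prepend \<Lambda> \<alpha> z) \<gamma>" "pre (prepend \<Lambda> \<beta> z) \<delta>"
    using prepend_props(2)[OF fa gd(1) u(1)] prepend_props(2)[OF fa gd(2) ud] u by simp_all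
  then obtain \<xi>1 \<xi>2 where x12: "pre z \<xi>1" "\<gamma> \<preceq> \<alpha> \<cdot> \<xi>1" "pre z \<xi>2" "\<delta> \<preceq> \<beta> \<cdot> \<xi>2"
    using pre_prepend_iff[OF fa ab(1) z] pre_prepend_iff[OF fa ab(2) zb] by blast
  obtain \<xi> where x: "pre z \<xi>" "\<xi>1 \<preceq> \<xi>" "\<xi>2 \<preceq> \<xi>" using pre_directed[OF k x12(1,3)] by metis
  have c: "\<alpha> \<bowtie> \<zeta>" "\<beta> \<bowtie> \<zeta>" if "pre z \<zeta>" for \<zeta>
    using that ab boundary_paths_atD(5)[OF z that] preD(1)[OF that] by (simp_all add: composable_def)
  have "\<gamma> \<preceq> \<alpha> \<cdot> \<xi>" "\<delta> \<preceq> \<beta> \<cdot> \<xi>"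
    using prefix_trans[OF x12(2)] prefix_trans[OF x12(4)] prefix_cmp_iff[OF c(1)[OF x12(1)] c(1)[OF x(1)]]
      prefix_cmp_iff[OF c(2)[OF x12(3)] c(2)[OF x(1)]] x(2,3) by simp_all
  then obtain \<gamma>' \<delta>' where g: "\<gamma> \<bowtie> \<gamma>'" "\<alpha> \<cdot> \<xi> = \<gamma> \<cdot> \<gamma>'" and d: "\<delta> \<bowtie> \<delta>'" "\<beta> \<cdot> \<xi> = \<delta> \<cdot> \<delta>'"
    by (metis prefixE)
  have "pre u \<gamma>'"
    using pre_prepend_cmp_iff[OF fa g(1) u(1)] pre_prepend_cmp_iff[OF fa c(1)[OF x(1)] z] x(1) g(2) u(2) by simp
  moreover have "pre u \<delta>'"
    using pre_prepend_cmp_iff[OF fa d(1) ud] pre_prepend_cmp_iff[OF fa c(2)[OF x(1)] zb] x(1) d(2) u(3) by simp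
  moreover have "deg \<Lambda> \<gamma>' = deg \<Lambda> \<delta>'"
  proof
    fix i
    have "deg \<Lambda> \<alpha> i + deg \<Lambda> \<xi> i = deg \<Lambda> \<gamma> i + deg \<Lambda> \<gamma>' i"
      using composableD(7)[OF g(1)] composableD(7)[OF c(1)[OF x(1)]] g(2) by (metis plus_fun_apply)
    moreover have "deg \<Lambda> \<beta> i + deg \<Lambda> \<xi> i = deg \<Lambda> \<delta> i + deg \<Lambda> \<delta>' i"
      using composableD(7)[OF d(1)] composableD(7)[OF c(2)[OF x(1)]] d(2) by (metis plus_fun_apply)
    moreover have "int (deg \<Lambda> \<alpha> i) - int (deg \<Lambda> \<beta> i) = int (deg \<Lambda> \<gamma> i) - int (deg \<Lambda> \<delta> i)"
      using fun_cong[OF m, of i] fun_cong[OF m', of i] by simp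
    ultimately show "deg \<Lambda> \<gamma>' i = deg \<Lambda> \<delta>' i" by linarith
  qed
  \<comment> \<open>Both are initial segments of u, and of the same degree.\<close>
  ultimately have eq: "\<delta>' = \<gamma>'" using pre_unique by metis
  show ?thesis
  proof (rule locally_at_mono[OF locally_at_pre[OF x(1)]])
    fix y assume y: "y \<in> boundary_paths \<Lambda>" "pre y \<xi>"
    define w where "w = shift (deg \<Lambda> \<xi>) y"
    have w: "w \<in> boundary_paths_at \<Lambda> (src \<Lambda> \<xi>)" "y = prepend \<Lambda> \<xi> w"
      using shift_at[OF y] prepend_shift[OF fa y] by (simp_all add: w_def)
    have "src \<Lambda> \<gamma>' = src \<Lambda> \<xi>" using g c(1)[OF x(1)] composableD(6) by metis
    then have wg: "w \<in> boundary_paths_at \<Lambda> (src \<Lambda> \<gamma>')" using w(1) by simp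
    have "prepend \<Lambda> \<alpha> y = prepend \<Lambda> \<gamma> (prepend \<Lambda> \<gamma>' w)"
      using prepend_prepend[OF fa c(1)[OF x(1)] w(1)] prepend_prepend[OF fa g(1) wg] g(2) w(2) by simp
    moreover have "prepend \<Lambda> \<beta> y = prepend \<Lambda> \<delta> (prepend \<Lambda> \<gamma>' w)"
      using prepend_prepend[OF fa c(2)[OF x(1)] w(1)] prepend_prepend[OF fa d(1)[unfolded eq] wg] d(2) eq w(2)
      by simp
    moreover have "prepend \<Lambda> \<gamma>' w \<in> boundary_paths_at \<Lambda> (src \<Lambda> \<gamma>)"
      using prepend_at[OF fa composableD(2)[OF g(1)] wg] composableD(3)[OF g(1)] by simp
    ultimately show "(prepend \<Lambda> \<alpha> y, m, prepend \<Lambda> \<beta> y) \<in> Zpair \<Lambda> \<gamma> \<delta>"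
      using Zpair_iff[OF fa gd] m' by blast
  qed
qed

text \<open>Continuity at z of the map sending y to (\<alpha>y, m, \<beta>y), by induction over the
  generation of the topology. On a basic set it combines membership in \<open>Zpair\<close> with
  finitely many excluded initial segments.\<close>

lemma locally_at_open:
  assumes fa: "finitely_aligned \<Lambda>" and ab: "\<alpha> \<in> mor \<Lambda>" "\<beta> \<in> mor \<Lambda>" "src \<Lambda> \<alpha> = src \<Lambda> \<beta>"
    and z: "z \<in> boundary_paths_at \<Lambda> (src \<Lambda> \<alpha>)"
    and U: "openin (topology_generated_by (bp_basis \<Lambda>)) U"
    and m: "m = intv (deg \<Lambda> \<alpha>) - intv (deg \<Lambda> \<beta>)"
    and mem: "(prepend \<Lambda> \<alpha> z, m, prepend \<Lambda> \<beta> z) \<in> U"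
  shows "locally_at z (\<lambda>y. (prepend \<Lambda> \<alpha> y, m, prepend \<Lambda> \<beta> y) \<in> U)"
    (is "locally_at z (\<lambda>y. ?a y \<in> U)")
proof -
  have "generate_topology_on (bp_basis \<Lambda>) U"
    using U by (simp add: openin_topology_generated_by_iff)
  then show ?thesis using mem
  proof induction
    case Empty then show ?case by simp
  next
    case (Int V W)
    then show ?case using locally_at_conj[of z "\<lambda>y. ?a y \<in> V" "\<lambda>y. ?a y \<in> W"] by simp
  next
    case (UN K)
    then obtain V where V: "V \<in> K" "?a z \<in> V" by blast
    show ?case using UN.IH[OF V] by (rule locally_at_mono) (use V in blast)
  next
    case (Basis V)
    then obtain \<gamma> \<delta> G where V: "V = Zminus \<Lambda> \<gamma> \<delta> G" "finite G" "G \<subseteq> out_of \<Lambda> (src \<Lambda> \<gamma>)"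
      and gd: "\<gamma> \<in> mor \<Lambda>" "\<delta> \<in> mor \<Lambda>" "src \<Lambda> \<gamma> = src \<Lambda> \<delta>"
      unfolding bp_basis_def by blast
    have c: "\<gamma> \<bowtie> \<nu>" "\<delta> \<bowtie> \<nu>" if "\<nu> \<in> G" for \<nu>
      using that V(3) gd by (auto simp: out_of_def composable_def)
    have Z: "?a z \<in> Zpair \<Lambda> \<gamma> \<delta>" using Basis.prems V(1) unfolding Zminus_def by blast
    have "\<not> pre (prepend \<Lambda> \<alpha> z) (\<gamma> \<cdot> \<nu>)" if "\<nu> \<in> G" for \<nu>
      using Basis.prems V(1) that Zpair_extend_iff[OF fa c[OF that] Z] unfolding Zminus_def by blast
    then have "locally_at z (\<lambda>y. \<forall>\<nu>\<in>G. \<not> pre (prepend \<Lambda> \<alpha> y) (\<gamma> \<cdot> \<nu>))"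
      using locally_at_ball[OF V(2)] locally_at_not_pre_prepend[OF fa ab(1) z] c(1) composableD(4) by simp
    with locally_at_Zpair[OF fa ab gd z m Z]
    have "locally_at z (\<lambda>y. ?a y \<in> Zpair \<Lambda> \<gamma> \<delta> \<and> (\<forall>\<nu>\<in>G. \<not> pre (prepend \<Lambda> \<alpha> y) (\<gamma> \<cdot> \<nu>)))"
      by (rule locally_at_conj)
    then show ?case
    proof (rule locally_at_mono)
      fix y assume y: "?a y \<in> Zpair \<Lambda> \<gamma> \<delta> \<and> (\<forall>\<nu>\<in>G. \<not> pre (prepend \<Lambda> \<alpha> y) (\<gamma> \<cdot> \<nu>))"
      then have "?a y \<notin> Zpair \<Lambda> (\<gamma> \<cdot> \<nu>) (\<delta> \<cdot> \<nu>)" if "\<nu> \<in> G" for \<nu>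
        using Zpair_extend_iff[OF fa c[OF that]] that by blast
      then show "?a y \<in> V" using y V(1) unfolding Zminus_def by blast
    qed
  qed
qed

lemma openin_Zpair:
  assumes "\<alpha> \<in> mor \<Lambda>" "\<beta> \<in> mor \<Lambda>" "src \<Lambda> \<alpha> = src \<Lambda> \<beta>"
  shows "openin (topology_generated_by (bp_basis \<Lambda>)) (Zpair \<Lambda> \<alpha> \<beta>)"
proof (rule topology_generated_by_Basis)
  \<comment> \<open>The vertex itself shows that the empty set is not exhaustive, which allows G =
    {} in the basis.\<close>
  have "src \<Lambda> \<alpha> \<in> out_of \<Lambda> (src \<Lambda> \<alpha>)"
    using assms(1) by (simp add: out_of_def src_mor rng_src)
  then have "\<not> exhaustive \<Lambda> (src \<Lambda> \<alpha>) {}" by (auto simp: exhaustive_def)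
  moreover have "Zpair \<Lambda> \<alpha> \<beta> = Zminus \<Lambda> \<alpha> \<beta> {}" by (simp add: Zminus_def)
  ultimately show "Zpair \<Lambda> \<alpha> \<beta> \<in> bp_basis \<Lambda>" using assms unfolding bp_basis_def by blast
qed

lemma unit_in_Zpair:
  assumes fa: "finitely_aligned \<Lambda>" and y: "y \<in> boundary_paths_at \<Lambda> v"
  shows "(y, 0, y) \<in> Zpair \<Lambda> v v"
proof -
  note V = vertsD[OF boundary_paths_atD(4)[OF y]]
  show ?thesis
    unfolding Zpair_iff[OF fa V(1) V(1) refl, unfolded V(4)]
    using y prepend_vertex[OF fa y] by (auto intro!: bexI[of _ y])
qed

section \<open>Units and the interior of the isotropy\<close>

lemma mem_unit_space_iff:
  assumes fa: "finitely_aligned \<Lambda>"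
  shows "a \<in> unit_space (boundary_path_groupoid \<Lambda>) \<longleftrightarrow> (\<exists>y\<in>boundary_paths \<Lambda>. a = (y, 0, y))"
proof
  assume "a \<in> unit_space (boundary_path_groupoid \<Lambda>)"
  then obtain b where b: "b \<in> bp_arrows \<Lambda>" "a = (\<lambda>(x, m, y). (y, 0, y)) b"
    by (auto simp: unit_space_def boundary_path_groupoid_def)
  from b(1) show "\<exists>y\<in>boundary_paths \<Lambda>. a = (y, 0, y)"
  proof (rule bp_arrowsE)
    fix \<alpha> \<beta> z assume *: "b = (prepend \<Lambda> \<alpha> z, intv (deg \<Lambda> \<alpha>) - intv (deg \<Lambda> \<beta>), prepend \<Lambda> \<beta> z)"
      "\<beta> \<in> mor \<Lambda>" "src \<Lambda> \<alpha> = src \<Lambda> \<beta>" "z \<in> boundary_paths_at \<Lambda> (src \<Lambda> \<alpha>)"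
    have "prepend \<Lambda> \<beta> z \<in> boundary_paths \<Lambda>" using prepend_props(1)[OF fa *(2)] *(3,4) by simp
    then show ?thesis using b(2) *(1) by simp
  qed
next
  assume "\<exists>y\<in>boundary_paths \<Lambda>. a = (y, 0, y)"
  then obtain y where y: "y \<in> boundary_paths_at \<Lambda> (prng y)" "a = (y, 0, y)"
    by (auto simp: boundary_paths_at_def)
  then have "(y, 0, y) \<in> bp_arrows \<Lambda>" using unit_in_Zpair[OF fa] unfolding Zpair_def by blast
  then show "a \<in> unit_space (boundary_path_groupoid \<Lambda>)"
    using y(2) by (auto simp: unit_space_def boundary_path_groupoid_def intro!: image_eqI[of _ _ "(y, 0, y)"])
qed

lemma mem_Iso_iff:
  "(x, m, y) \<in> Iso (boundary_path_groupoid \<Lambda>) \<longleftrightarrow> (x, m, y) \<in> bp_arrows \<Lambda> \<and> x = y"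
  by (auto simp: Iso_def boundary_path_groupoid_def)

text \<open>With v the range of y, the open set \<open>Zpair \<Lambda> v v\<close> contains the unit
  at y, and both ends of each of its arrows are the same vz.\<close>

lemma unit_space_subset_interior:
  assumes fa: "finitely_aligned \<Lambda>"
  shows "unit_space (boundary_path_groupoid \<Lambda>) \<subseteq>
    topology_generated_by (bp_basis \<Lambda>) interior_of Iso (boundary_path_groupoid \<Lambda>)"
proof
  fix a assume "a \<in> unit_space (boundary_path_groupoid \<Lambda>)"
  then obtain y where y: "y \<in> boundary_paths_at \<Lambda> (prng y)" "a = (y, 0, y)"
    using mem_unit_space_iff[OF fa] by (auto simp: boundary_paths_at_def)
  define v where "v = prng y"
  have yv: "y \<in> boundary_paths_at \<Lambda> v" using y(1) by (simp add: v_def)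
  note V = vertsD[OF boundary_paths_atD(4)[OF yv]]
  note Z = Zpair_iff[OF fa V(1) V(1) refl, unfolded V(4)]
  have "a \<in> Zpair \<Lambda> v v" using unit_in_Zpair[OF fa yv] y(2) by simp
  moreover have "Zpair \<Lambda> v v \<subseteq> Iso (boundary_path_groupoid \<Lambda>)"
  proof
    fix b assume b: "b \<in> Zpair \<Lambda> v v"
    obtain x m w where xw: "b = (x, m, w)" by (cases b)
    have "b \<in> bp_arrows \<Lambda>" using b unfolding Zpair_def by blast
    moreover have "x = w" using b unfolding xw Z by auto
    ultimately show "b \<in> Iso (boundary_path_groupoid \<Lambda>)" by (simp add: xw mem_Iso_iff)
  qed
  ultimately show "a \<in> topology_generated_by (bp_basis \<Lambda>) interior_of Iso (boundary_path_groupoid \<Lambda>)"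
    using openin_Zpair[OF V(1) V(1) refl] unfolding interior_of_def by blast
qed

text \<open>Units always lie in the interior of the isotropy, so only the other inclusion is at
  stake, and it can be tested on open sets.\<close>

lemma effective_iff:
  assumes "finitely_aligned \<Lambda>"
  shows "effective (boundary_path_groupoid \<Lambda>) \<longleftrightarrow>
    (\<forall>U. openin (topology_generated_by (bp_basis \<Lambda>)) U \<longrightarrow> U \<subseteq> Iso (boundary_path_groupoid \<Lambda>) \<longrightarrow>
      U \<subseteq> unit_space (boundary_path_groupoid \<Lambda>))"
proof -
  let ?X = "topology_generated_by (bp_basis \<Lambda>)" and ?I = "Iso (boundary_path_groupoid \<Lambda>)"
  let ?X = "topology_generated_by (bp_basis \<Lambda>)" and ?I = "Iso (boundary_path_groupoid \<Lambda>)"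
    and ?U = "unit_space (boundary_path_groupoid \<Lambda>)"
  have "gtop (boundary_path_groupoid \<Lambda>) = ?X"
    by (simp add: boundary_path_groupoid_def)
  then have "effective (boundary_path_groupoid \<Lambda>) \<longleftrightarrow> ?X interior_of ?I = ?U"
    by (simp only: effective_def)
  also have "\<dots> \<longleftrightarrow> ?X interior_of ?I \<subseteq> ?U"
    using unit_space_subset_interior[OF assms] by blast
  also have "\<dots> \<longleftrightarrow> (\<forall>V. openin ?X V \<longrightarrow> V \<subseteq> ?I \<longrightarrow> V \<subseteq> ?U)"
    unfolding interior_of_def by blast
  finally show ?thesis .
qed

section \<open>Aperiodicity implies effectiveness\<close>

lemma aperiodic_imp_effective:
  assumes fa: "finitely_aligned \<Lambda>" and ap: "aperiodic \<Lambda>"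
  shows "effective (boundary_path_groupoid \<Lambda>)"
  unfolding effective_iff[OF fa]
proof (intro allI impI subsetI)
  fix U a assume U: "openin (topology_generated_by (bp_basis \<Lambda>)) U"
    "U \<subseteq> Iso (boundary_path_groupoid \<Lambda>)" and a: "a \<in> U"
  have "a \<in> bp_arrows \<Lambda>" using a U(2) by (auto simp: Iso_def boundary_path_groupoid_def)
  then obtain \<alpha> \<beta> z where
      az: "a = (prepend \<Lambda> \<alpha> z, intv (deg \<Lambda> \<alpha>) - intv (deg \<Lambda> \<beta>), prepend \<Lambda> \<beta> z)"
    and ab: "\<alpha> \<in> mor \<Lambda>" "\<beta> \<in> mor \<Lambda>" "src \<Lambda> \<alpha> = src \<Lambda> \<beta>"
    and z: "z \<in> boundary_paths_at \<Lambda> (src \<Lambda> \<alpha>)"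
    by (rule bp_arrowsE)
  have "locally_at z (\<lambda>y. (prepend \<Lambda> \<alpha> y, intv (deg \<Lambda> \<alpha>) - intv (deg \<Lambda> \<beta>), prepend \<Lambda> \<beta> y) \<in> U)"
    by (rule locally_at_open[OF fa ab z U(1) refl a[unfolded az]])
  \<comment> \<open>All arrows in U are isotropy, so their two ends coincide.\<close>
  then have "locally_at z (\<lambda>y. prepend \<Lambda> \<alpha> y = prepend \<Lambda> \<beta> y)"
    by (rule locally_at_mono) (use U(2) mem_Iso_iff in blast)
  then obtain \<mu> where m: "\<mu> \<in> mor \<Lambda>" "rng \<Lambda> \<mu> = prng z"
      "\<forall>y\<in>boundary_paths \<Lambda>. pre y \<mu> \<longrightarrow> prepend \<Lambda> \<alpha> y = prepend \<Lambda> \<beta> y"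
    using locally_at_cylinder[OF fa boundary_paths_atD(1)[OF z]] by blast
  have am: "\<alpha> \<bowtie> \<mu>" and bm: "\<beta> \<bowtie> \<mu>"
    using ab m(1,2) boundary_paths_atD(3)[OF z] by (simp_all add: composable_def)
  \<comment> \<open>The aperiodic path is taken at the source of \<mu>: the coincidence holds on the
    whole cylinder of \<mu>, so \<mu>w may replace z.\<close>
  obtain w where w: "w \<in> boundary_paths_at \<Lambda> (src \<Lambda> \<mu>)" "aperiodic_path \<Lambda> w"
    using ap src_in_verts[OF m(1)] unfolding aperiodic_def by blast
  have "prepend \<Lambda> (\<alpha> \<cdot> \<mu>) w = prepend \<Lambda> (\<beta> \<cdot> \<mu>) w"
    using m(3) prepend_props(1,2)[OF fa m(1) w(1)] prepend_prepend[OF fa am w(1)]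
      prepend_prepend[OF fa bm w(1)] by simp
  moreover have "\<alpha> \<cdot> \<mu> \<in> into \<Lambda> (prng w)" "\<beta> \<cdot> \<mu> \<in> into \<Lambda> (prng w)"
    using composableD[OF am] composableD[OF bm] boundary_paths_atD(3)[OF w(1)] by (simp_all add: into_def)
  ultimately have "\<alpha> \<cdot> \<mu> = \<beta> \<cdot> \<mu>" using w(2) unfolding aperiodic_path_def by blast
  then have "\<alpha> = \<beta>" using cmp_right_cancel[OF am bm] by blast
  then show "a \<in> unit_space (boundary_path_groupoid \<Lambda>)"
    using az prepend_props(1)[OF fa ab(1) z] mem_unit_space_iff[OF fa] by simp
qed

section \<open>Effectiveness implies aperiodicity\<close>

text \<open>Morphisms whose cylinder contains no y with \<alpha>y = \<beta>y. The guard on the range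
  admits every morphism with another range, so that density can be asked over all of
  \<Lambda>.\<close>

definition separating :: "'a \<Rightarrow> 'a \<Rightarrow> 'a set" where
  "separating \<alpha> \<beta> = {\<mu> \<in> mor \<Lambda>. rng \<Lambda> \<mu> = src \<Lambda> \<alpha> \<longrightarrow>
     (\<forall>y\<in>boundary_paths \<Lambda>. pre y \<mu> \<longrightarrow> prepend \<Lambda> \<alpha> y \<noteq> prepend \<Lambda> \<beta> y)}"

text \<open>Distinct paths are told apart by one morphism \<phi> that is an initial segment of only
  one of them, and both having and lacking \<phi> persist nearby.\<close>

lemma locally_at_prepend_neq:
  assumes fa: "finitely_aligned \<Lambda>" and ab: "\<alpha> \<in> mor \<Lambda>" "\<beta> \<in> mor \<Lambda>" "src \<Lambda> \<alpha> = src \<Lambda> \<beta>"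
    and z: "z \<in> boundary_paths_at \<Lambda> (src \<Lambda> \<alpha>)" and neq: "prepend \<Lambda> \<alpha> z \<noteq> prepend \<Lambda> \<beta> z"
  shows "locally_at z (\<lambda>y. prepend \<Lambda> \<alpha> y \<noteq> prepend \<Lambda> \<beta> y)"
proof -
  have zb: "z \<in> boundary_paths_at \<Lambda> (src \<Lambda> \<beta>)" using z ab(3) by simp
  have "kpath (prepend \<Lambda> \<alpha> z)" "kpath (prepend \<Lambda> \<beta> z)"
    using prepend_props(1)[OF fa ab(1) z] prepend_props(1)[OF fa ab(2) zb] boundaryD(1) by blast+
  then obtain \<phi> where p: "pre (prepend \<Lambda> \<alpha> z) \<phi> \<noteq> pre (prepend \<Lambda> \<beta> z) \<phi>"
    using kpath_eqI neq by blast
  then have f: "\<phi> \<in> mor \<Lambda>" using preD(1) by blast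
  have "locally_at z (\<lambda>y. pre (prepend \<Lambda> \<alpha> y) \<phi> \<noteq> pre (prepend \<Lambda> \<beta> y) \<phi>)"
  proof (cases "pre (prepend \<Lambda> \<alpha> z) \<phi>")
    case True
    then have "\<not> pre (prepend \<Lambda> \<beta> z) \<phi>" using p by simp
    from locally_at_conj[OF locally_at_pre_prepend[OF fa ab(1) z True]
        locally_at_not_pre_prepend[OF fa ab(2) zb f this]]
    show ?thesis by (rule locally_at_mono) simp
  next
    case False
    then have "pre (prepend \<Lambda> \<beta> z) \<phi>" using p by simp
    from locally_at_conj[OF locally_at_pre_prepend[OF fa ab(2) zb this]
        locally_at_not_pre_prepend[OF fa ab(1) z f False]]
    show ?thesis by (rule locally_at_mono) simp
  qed
  then show ?thesis by (rule locally_at_mono) auto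
qed

lemma dense_separating:
  assumes fa: "finitely_aligned \<Lambda>" and eff: "effective (boundary_path_groupoid \<Lambda>)"
    and ab: "\<alpha> \<in> mor \<Lambda>" "\<beta> \<in> mor \<Lambda>" "src \<Lambda> \<alpha> = src \<Lambda> \<beta>" "\<alpha> \<noteq> \<beta>"
  shows "dense_set (separating \<alpha> \<beta>)"
  unfolding dense_set_def
proof
  fix \<mu> assume m: "\<mu> \<in> mor \<Lambda>"
  show "\<exists>\<phi>\<in>separating \<alpha> \<beta>. \<mu> \<preceq> \<phi>"
  proof (cases "rng \<Lambda> \<mu> = src \<Lambda> \<alpha>")
    case False
    then show ?thesis using m prefix_refl by (auto simp: separating_def)
  next
    case True
    have am: "\<alpha> \<bowtie> \<mu>" and bm: "\<beta> \<bowtie> \<mu>" using True m ab by (simp_all add: composable_def)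
    note a = composableD[OF am] and b = composableD[OF bm]
    have s: "src \<Lambda> (\<alpha> \<cdot> \<mu>) = src \<Lambda> (\<beta> \<cdot> \<mu>)" using a b by simp
    note Z = Zpair_iff[OF fa a(4) b(4) s]
    have "\<exists>y\<in>boundary_paths \<Lambda>. pre y \<mu> \<and> prepend \<Lambda> \<alpha> y \<noteq> prepend \<Lambda> \<beta> y"
    proof (rule ccontr)
      assume "\<not> ?thesis"
      then have per: "prepend \<Lambda> (\<alpha> \<cdot> \<mu>) w = prepend \<Lambda> (\<beta> \<cdot> \<mu>) w" if "w \<in> boundary_paths_at \<Lambda> (src \<Lambda> \<mu>)" for w
        using prepend_props(1,2)[OF fa m that] prepend_prepend[OF fa am that] prepend_prepend[OF fa bm that]
        by metis
      have "Zpair \<Lambda> (\<alpha> \<cdot> \<mu>) (\<beta> \<cdot> \<mu>) \<subseteq> Iso (boundary_path_groupoid \<Lambda>)"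
      proof
        fix c assume c: "c \<in> Zpair \<Lambda> (\<alpha> \<cdot> \<mu>) (\<beta> \<cdot> \<mu>)"
        obtain x n y where xy: "c = (x, n, y)" by (cases c)
        have "c \<in> bp_arrows \<Lambda>" using c unfolding Zpair_def by blast
        moreover have "x = y" using c per unfolding xy Z a(6) by auto
        ultimately show "c \<in> Iso (boundary_path_groupoid \<Lambda>)" by (simp add: xy mem_Iso_iff)
      qed
      then have units: "Zpair \<Lambda> (\<alpha> \<cdot> \<mu>) (\<beta> \<cdot> \<mu>) \<subseteq> unit_space (boundary_path_groupoid \<Lambda>)"
        using eff openin_Zpair[OF a(4) b(4) s] unfolding effective_iff[OF fa] by blast
      obtain w where w: "w \<in> boundary_paths_at \<Lambda> (src \<Lambda> \<mu>)"
        using boundary_path_ex[OF src_in_verts[OF m]] by blast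
      let ?d = "intv (deg \<Lambda> (\<alpha> \<cdot> \<mu>)) - intv (deg \<Lambda> (\<beta> \<cdot> \<mu>))"
      have "(prepend \<Lambda> (\<alpha> \<cdot> \<mu>) w, ?d, prepend \<Lambda> (\<beta> \<cdot> \<mu>) w) \<in> Zpair \<Lambda> (\<alpha> \<cdot> \<mu>) (\<beta> \<cdot> \<mu>)"
        using Z w a(6) by auto
      \<comment> \<open>A unit has middle entry 0. So \<alpha>\<mu> and \<beta>\<mu> have equal
        degree, and as initial segments of the same path they coincide.\<close>
      then have "?d = 0" using units mem_unit_space_iff[OF fa] by blast
      then have "deg \<Lambda> (\<alpha> \<cdot> \<mu>) = deg \<Lambda> (\<beta> \<cdot> \<mu>)" by (simp add: fun_eq_iff)
      moreover have "pre (prepend \<Lambda> (\<alpha> \<cdot> \<mu>) w) (\<alpha> \<cdot> \<mu>)" "pre (prepend \<Lambda> (\<alpha> \<cdot> \<mu>) w) (\<beta> \<cdot> \<mu>)"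
        using prepend_props(2)[OF fa a(4), of w] prepend_props(2)[OF fa b(4), of w] per[OF w] w a(6) b(6)
        by simp_all
      ultimately have "\<alpha> \<cdot> \<mu> = \<beta> \<cdot> \<mu>" using pre_unique by blast
      then show False using cmp_right_cancel[OF am bm] ab(4) by blast
    qed
    then obtain y where y: "y \<in> boundary_paths \<Lambda>" "pre y \<mu>" "prepend \<Lambda> \<alpha> y \<noteq> prepend \<Lambda> \<beta> y" by blast
    have ya: "y \<in> boundary_paths_at \<Lambda> (src \<Lambda> \<alpha>)"
      using y(1) kpath_vertex(2)[OF boundaryD(1)[OF y(1)] y(2)] True by (simp add: boundary_paths_at_def)
    \<comment> \<open>The cylinder found next need not lie inside that of \<mu>; the second conjunct
      makes its paths start with \<mu>, which yields a common extension \<eta>.\<close>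
    have "locally_at y (\<lambda>y'. prepend \<Lambda> \<alpha> y' \<noteq> prepend \<Lambda> \<beta> y' \<and> pre y' \<mu>)"
      using locally_at_conj[OF locally_at_prepend_neq[OF fa ab(1-3) ya y(3)] locally_at_pre[OF y(2)]] .
    from locally_at_cylinder[OF fa y(1) this]
    obtain \<nu> where n: "\<nu> \<in> mor \<Lambda>"
        "\<forall>y'\<in>boundary_paths \<Lambda>. pre y' \<nu> \<longrightarrow> prepend \<Lambda> \<alpha> y' \<noteq> prepend \<Lambda> \<beta> y' \<and> pre y' \<mu>"
      by blast
    obtain y' where y': "y' \<in> boundary_paths \<Lambda>" "pre y' \<nu>"
      using boundary_path_through[OF fa n(1)] by blast
    obtain \<eta> where e: "\<nu> \<preceq> \<eta>" "\<mu> \<preceq> \<eta>"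
      using pre_directed[OF boundaryD(1)[OF y'(1)] y'(2)] n(2) y' by metis
    have "prepend \<Lambda> \<alpha> w \<noteq> prepend \<Lambda> \<beta> w" if "w \<in> boundary_paths \<Lambda>" "pre w \<eta>" for w
      using n(2) that pre_prefix[OF boundaryD(1) _ e(1)] by blast
    then have "\<eta> \<in> separating \<alpha> \<beta>" using prefixD(2)[OF e(1)] by (simp add: separating_def)
    then show ?thesis using e(2) by blast
  qed
qed

text \<open>Only countably many pairs of distinct morphisms have source v. A generic path at v meets
  the separating set of each pair, hence is aperiodic.\<close>

lemma effective_imp_aperiodic:
  assumes fa: "finitely_aligned \<Lambda>" and eff: "effective (boundary_path_groupoid \<Lambda>)"
  shows "aperiodic \<Lambda>"
  unfolding aperiodic_def
proof
  fix v assume v: "v \<in> verts \<Lambda>"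
  define P where "P = {(\<alpha>, \<beta>). \<alpha> \<in> into \<Lambda> v \<and> \<beta> \<in> into \<Lambda> v \<and> \<alpha> \<noteq> \<beta>}"
  have "P \<subseteq> mor \<Lambda> \<times> mor \<Lambda>" by (auto simp: P_def into_def)
  then have "countable P" using countable_mor countable_SIGMA countable_subset by metis
  then have "countable (case_prod separating ` P)" by simp
  moreover have "dense_set D" if D: "D \<in> case_prod separating ` P" for D
  proof -
    obtain \<alpha> \<beta> where "D = separating \<alpha> \<beta>" "\<alpha> \<in> mor \<Lambda>" "\<beta> \<in> mor \<Lambda>" "src \<Lambda> \<alpha> = src \<Lambda> \<beta>" "\<alpha> \<noteq> \<beta>"
      using D by (auto simp: P_def into_def)
    then show ?thesis using dense_separating[OF fa eff] by simp
  qed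
  ultimately obtain x where x: "x \<in> boundary_paths_at \<Lambda> v"
      "\<And>D. D \<in> case_prod separating ` P \<Longrightarrow> \<exists>\<phi>\<in>D. pre x \<phi>"
    using generic_boundary_path[OF _ _ v] by metis
  have "aperiodic_path \<Lambda> x"
    unfolding aperiodic_path_def
  proof (intro ballI impI)
    fix \<alpha> \<beta> assume ab: "\<alpha> \<in> into \<Lambda> (prng x)" "\<beta> \<in> into \<Lambda> (prng x)" "\<alpha> \<noteq> \<beta>"
    then have "(\<alpha>, \<beta>) \<in> P" using boundary_paths_atD(3)[OF x(1)] by (simp add: P_def)
    then obtain \<phi> where p: "\<phi> \<in> separating \<alpha> \<beta>" "pre x \<phi>" using x(2) by force
    \<comment> \<open>This discharges the guard in \<open>separating\<close>: initial segments of x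
      have range v, the source of \<alpha>.\<close>
    have "rng \<Lambda> \<phi> = src \<Lambda> \<alpha>"
      using boundary_paths_atD(3,5)[OF x(1)] p(2) ab(1) by (simp add: into_def)
    then show "prepend \<Lambda> \<alpha> x \<noteq> prepend \<Lambda> \<beta> x"
      using p boundary_paths_atD(1)[OF x(1)] by (simp add: separating_def)
  qed
  then show "\<exists>x\<in>boundary_paths_at \<Lambda> v. aperiodic_path \<Lambda> x" using x(1) by blast
qed

end

theorem proposition6p3:
  fixes \<Lambda> :: "('a, 'k::finite) kgraph_data"
  assumes "k_graph \<Lambda>"
    and "finitely_aligned \<Lambda>"
  shows "aperiodic \<Lambda> \<longleftrightarrow> effective (boundary_path_groupoid \<Lambda>)"
proof -
  interpret k_graph \<Lambda> by fact
  show ?thesis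
    using aperiodic_imp_effective[OF assms(2)] effective_imp_aperiodic[OF assms(2)] by blast
qed

end
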